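(* The cut rule is admissible for system $\mathcal D$: every sequent derivable in $\mathcal D$ has a derivation in $\mathcal D$ without instances of the cut rule.
   Context: Fix countably infinite sets of names and variables and the constructors $\mathsf{pub}$ (unary) and $\mathsf{sign},\mathsf{blind},\langle\cdot,\cdot\rangle,\{\cdot\}_{\cdot}$ (binary). Let $E$ be the union of AC-convergent equational theories $E_1,\dots,E_n$ with pairwise disjoint signatures $\Sigma_{E_i}$, all disjoint from the constructors, each containing at most one associative-commutative (AC) binary symbol $\oplus_i$; $E$ is presented by a rewrite system $R_E$ terminating and confluent modulo AC; $\Sigma_E=\bigcup_i\Sigma_{E_i}$. Terms: names, variables, $\mathsf{pub}(M)$, $\mathsf{sign}(M,N)$, $\mathsf{blind}(M,N)$, $\langle M,N\rangle$, $\{M\}_N$, $g(M_1,\dots,M_j)$ with $g\in\Sigma_E$; all ground. $\equiv$ is equality modulo AC of all $\oplus_i$; $\approx_E$ equality modulo $E$. A term is guarded if it is a name, a variable, or headed by a constructor. An $E_i$-context is a term with holes built only from function symbols of $\Sigma_{E_i}$. A subterm occurrence $N$ of $M$ is a cross-theory subterm if $N$ is headed by a symbol of some $\Sigma_{E_i}$ and is an immediate argument of a subterm of $M$ headed by a symbol of $\Sigma_{E_j}$, $j\neq i$. A sequent $\Gamma\vdash M$: finite set $\Gamma$ of terms and term $M$, all in $R_E$-normal form modulo AC; $\Gamma,M$ means $\Gamma\cup\{M\}$. System $\mathcal D$ has the rules: ($id_{E_i}$, for each $i$) $\Gamma\vdash M$ with no premise if $M\approx_E C[M_1,\dots,M_k]$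 for some $E_i$-context $C$ and $M_1,\dots,M_k\in\Gamma$; (cut) from $\Gamma\vdash M$ and $\Gamma,M\vdash T$ infer $\Gamma\vdash T$; ($p_L$) from $\Gamma,\langle M,N\rangle,M,N\vdash T$ infer $\Gamma,\langle M,N\rangle\vdash T$; ($p_R$) from $\Gamma\vdash M$, $\Gamma\vdash N$ infer $\Gamma\vdash\langle M,N\rangle$; ($e_L$) from $\Gamma,\{M\}_K\vdash K$ and $\Gamma,\{M\}_K,M,K\vdash N$ infer $\Gamma,\{M\}_K\vdash N$; ($e_R$) from $\Gamma\vdash M$, $\Gamma\vdash K$ infer $\Gamma\vdash\{M\}_K$; ($\mathsf{sign}_L$) from $\Gamma,\mathsf{sign}(M,K),\mathsf{pub}(L),M\vdash N$ infer $\Gamma,\mathsf{sign}(M,K),\mathsf{pub}(L)\vdash N$, provided $K\equiv L$; ($\mathsf{sign}_R$) from $\Gamma\vdash M$, $\Gamma\vdash K$ infer $\Gamma\vdash\mathsf{sign}(M,K)$; ($\mathsf{blind}_{L1}$) from $\Gamma,\mathsf{blind}(M,K)\vdash K$ and $\Gamma,\mathsf{blind}(M,K),M,K\vdash N$ infer $\Gamma,\mathsf{blind}(M,K)\vdash N$; ($\mathsf{blind}_R$) from $\Gamma\vdash M$, $\Gamma\vdash K$ infer $\Gamma\vdash\mathsf{blind}(M,K)$; ($\mathsf{blind}_{L2}$) from $\Gamma,\mathsf{sign}(\mathsf{blind}(M,R),K)\vdash R$ and $\Gamma,\mathsf{sign}(\mathsf{blind}(M,R),K),\mathsf{sign}(M,K),R\vdash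 N$ infer $\Gamma,\mathsf{sign}(\mathsf{blind}(M,R),K)\vdash N$; ($gs$) from $\Gamma\vdash A$ and $\Gamma,A\vdash M$ infer $\Gamma\vdash M$, provided $A$ is a guarded subterm of a term in $\Gamma\cup\{M\}$; ($cs$) from $\Gamma\vdash N$ and $\Gamma,N\vdash M$ infer $\Gamma\vdash M$, provided $N$ is a cross-theory subterm of a term in $\Gamma\cup\{M\}$. *)

theory Defs
  imports Main
begin

text \<open>Names Nm, variables Vr (both indexed by nat, countably infinite), the
constructors pub, sign, blind, pairing and symmetric encryption (Enc M K = {M}_K),
and applications of equational function symbols of type 'f.\<close>

datatype 'f trm =
    Nm nat
  | Vr nat
  | Pub "'f trm"
  | Sign "'f trm" "'f trm"
  | Blind "'f trm" "'f trm"
  | Pair "'f trm" "'f trm"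
  | Enc "'f trm" "'f trm"
  | Fn 'f "'f trm list"

text \<open>Patterns for equations / rewrite rules: only equational symbols and pattern variables.\<close>
datatype 'f pat = PV nat | PF 'f "'f pat list"

fun inst :: "(nat \<Rightarrow> 'f trm) \<Rightarrow> 'f pat \<Rightarrow> 'f trm" where
  "inst \<sigma> (PV x) = \<sigma> x"
| "inst \<sigma> (PF f ps) = Fn f (map (inst \<sigma>) ps)"

fun pat_over :: "('f \<Rightarrow> nat) \<Rightarrow> ('f \<Rightarrow> bool) \<Rightarrow> 'f pat \<Rightarrow> bool" where
  "pat_over ar P (PV x) = True"
| "pat_over ar P (PF f ps) = (P f \<and> length ps = ar f \<and> (\<forall>p\<in>set ps. pat_over ar P p))"

text \<open>Well-formed terms: equational symbols belong to \<Sigma>_E = {f. th f < n} and respect arity.\<close>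
fun wf_trm :: "('f \<Rightarrow> nat) \<Rightarrow> ('f \<Rightarrow> nat) \<Rightarrow> nat \<Rightarrow> 'f trm \<Rightarrow> bool" where
  "wf_trm ar th n (Nm a) = True"
| "wf_trm ar th n (Vr x) = True"
| "wf_trm ar th n (Pub M) = wf_trm ar th n M"
| "wf_trm ar th n (Sign M N) = (wf_trm ar th n M \<and> wf_trm ar th n N)"
| "wf_trm ar th n (Blind M N) = (wf_trm ar th n M \<and> wf_trm ar th n N)"
| "wf_trm ar th n (Pair M N) = (wf_trm ar th n M \<and> wf_trm ar th n N)"
| "wf_trm ar th n (Enc M N) = (wf_trm ar th n M \<and> wf_trm ar th n N)"
| "wf_trm ar th n (Fn f ts) = (th f < n \<and> length ts = ar f \<and> (\<forall>t\<in>set ts. wf_trm ar th n t))"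

fun subterms :: "'f trm \<Rightarrow> 'f trm set" where
  "subterms (Nm a) = {Nm a}"
| "subterms (Vr x) = {Vr x}"
| "subterms (Pub M) = insert (Pub M) (subterms M)"
| "subterms (Sign M N) = insert (Sign M N) (subterms M \<union> subterms N)"
| "subterms (Blind M N) = insert (Blind M N) (subterms M \<union> subterms N)"
| "subterms (Pair M N) = insert (Pair M N) (subterms M \<union> subterms N)"
| "subterms (Enc M N) = insert (Enc M N) (subterms M \<union> subterms N)"
| "subterms (Fn f ts) = insert (Fn f ts) (\<Union>t\<in>set ts. subterms t)"

fun guarded :: "'f trm \<Rightarrow> bool" where
  "guarded (Fn f ts) = False"
| "guarded _ = True"

text \<open>Cross-theory subterms of M (th f = index of the theory E_i containing f).\<close>
definition cross_sub :: "('f \<Rightarrow> nat) \<Rightarrow> 'f trm \<Rightarrow> 'f trm set" where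
  "cross_sub th M = {N. \<exists>f ts g us. Fn f ts \<in> subterms M \<and> N \<in> set ts \<and> N = Fn g us \<and> th g \<noteq> th f}"

inductive_set ctxt_cl :: "('f trm \<times> 'f trm) set \<Rightarrow> ('f trm \<times> 'f trm) set" for S where
  base: "(s, t) \<in> S \<Longrightarrow> (s, t) \<in> ctxt_cl S"
| pub: "(s, t) \<in> ctxt_cl S \<Longrightarrow> (Pub s, Pub t) \<in> ctxt_cl S"
| sign1: "(s, t) \<in> ctxt_cl S \<Longrightarrow> (Sign s u, Sign t u) \<in> ctxt_cl S"
| sign2: "(s, t) \<in> ctxt_cl S \<Longrightarrow> (Sign u s, Sign u t) \<in> ctxt_cl S"
| blind1: "(s, t) \<in> ctxt_cl S \<Longrightarrow> (Blind s u, Blind t u) \<in> ctxt_cl S"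
| blind2: "(s, t) \<in> ctxt_cl S \<Longrightarrow> (Blind u s, Blind u t) \<in> ctxt_cl S"
| pair1: "(s, t) \<in> ctxt_cl S \<Longrightarrow> (Pair s u, Pair t u) \<in> ctxt_cl S"
| pair2: "(s, t) \<in> ctxt_cl S \<Longrightarrow> (Pair u s, Pair u t) \<in> ctxt_cl S"
| enc1: "(s, t) \<in> ctxt_cl S \<Longrightarrow> (Enc s u, Enc t u) \<in> ctxt_cl S"
| enc2: "(s, t) \<in> ctxt_cl S \<Longrightarrow> (Enc u s, Enc u t) \<in> ctxt_cl S"
| fn: "(s, t) \<in> ctxt_cl S \<Longrightarrow> (Fn f (xs @ s # ys), Fn f (xs @ t # ys)) \<in> ctxt_cl S"

definition acroot :: "('f \<Rightarrow> bool) \<Rightarrow> ('f trm \<times> 'f trm) set" where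
  "acroot A = {(Fn f [a, b], Fn f [b, a]) | f a b. A f}
            \<union> {(Fn f [Fn f [a, b], c], Fn f [a, Fn f [b, c]]) | f a b c. A f}"

definition ac_step :: "('f \<Rightarrow> bool) \<Rightarrow> ('f trm \<times> 'f trm) set" where
  "ac_step A = ctxt_cl (acroot A)"

definition aceq :: "('f \<Rightarrow> bool) \<Rightarrow> ('f trm \<times> 'f trm) set" where
  "aceq A = (ac_step A \<union> (ac_step A)\<inverse>)\<^sup>*"

definition rroot :: "('f pat \<times> 'f pat) set \<Rightarrow> ('f trm \<times> 'f trm) set" where
  "rroot R = {(inst \<sigma> l, inst \<sigma> r) | \<sigma> l r. (l, r) \<in> R}"

definition rstep :: "('f pat \<times> 'f pat) set \<Rightarrow> ('f trm \<times> 'f trm) set" where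
  "rstep R = ctxt_cl (rroot R)"

definition conv :: "('f \<Rightarrow> bool) \<Rightarrow> ('f pat \<times> 'f pat) set \<Rightarrow> ('f trm \<times> 'f trm) set" where
  "conv A R = (rstep R \<union> (rstep R)\<inverse> \<union> ac_step A \<union> (ac_step A)\<inverse>)\<^sup>*"

definition rmod :: "('f \<Rightarrow> bool) \<Rightarrow> ('f pat \<times> 'f pat) set \<Rightarrow> ('f trm \<times> 'f trm) set" where
  "rmod A R = aceq A O rstep R O aceq A"

definition convergent_mod :: "('f \<Rightarrow> bool) \<Rightarrow> ('f pat \<times> 'f pat) set \<Rightarrow> bool" where
  "convergent_mod A R \<longleftrightarrow> wf ((rmod A R)\<inverse>) \<and>
     (\<forall>s t. (s, t) \<in> conv A R \<longrightarrow>
        (\<exists>s' t'. (s, s') \<in> (rmod A R)\<^sup>* \<and> (t, t') \<in> (rmod A R)\<^sup>* \<and> (s', t') \<in> aceq A))"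

definition nf_mod :: "('f \<Rightarrow> bool) \<Rightarrow> ('f pat \<times> 'f pat) set \<Rightarrow> 'f trm \<Rightarrow> bool" where
  "nf_mod A R t \<longleftrightarrow> \<not> (\<exists>u. (t, u) \<in> rmod A R)"

text \<open>Terms C[M_1,...,M_k] with C an E_i-context and M_j \<in> \<Gamma>.\<close>
inductive_set ectx :: "('f \<Rightarrow> nat) \<Rightarrow> ('f \<Rightarrow> nat) \<Rightarrow> nat \<Rightarrow> 'f trm set \<Rightarrow> 'f trm set"
  for ar th i \<Gamma> where
  hole: "M \<in> \<Gamma> \<Longrightarrow> M \<in> ectx ar th i \<Gamma>"
| app: "th f = i \<Longrightarrow> length ts = ar f \<Longrightarrow> \<forall>t\<in>set ts. t \<in> ectx ar th i \<Gamma> \<Longrightarrow> Fn f ts \<in> ectx ar th i \<Gamma>"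

definition seqok :: "('f \<Rightarrow> nat) \<Rightarrow> ('f \<Rightarrow> nat) \<Rightarrow> ('f \<Rightarrow> bool) \<Rightarrow> nat \<Rightarrow> ('f pat \<times> 'f pat) set
     \<Rightarrow> 'f trm set \<Rightarrow> 'f trm \<Rightarrow> bool" where
  "seqok ar th ac n RE \<Gamma> M \<longleftrightarrow> finite \<Gamma> \<and>
     (\<forall>t\<in>insert M \<Gamma>. wf_trm ar th n t \<and> nf_mod ac RE t)"

text \<open>D ... c \<Gamma> M: \<Gamma> \<turnstile> M is derivable; the cut rule is available only when c = True.
 Every rule requires its conclusion to be a sequent (so all derivable judgements are sequents).
 The AC symbols are those f with ac f; \<approx>_E is conv ac (\<Union>i<n. Es i).\<close>
inductive D :: "('f \<Rightarrow> nat) \<Rightarrow> ('f \<Rightarrow> nat) \<Rightarrow> ('f \<Rightarrow> bool) \<Rightarrow> nat \<Rightarrow> (nat \<Rightarrow> ('f pat \<times> 'f pat) set)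
     \<Rightarrow> ('f pat \<times> 'f pat) set \<Rightarrow> bool \<Rightarrow> 'f trm set \<Rightarrow> 'f trm \<Rightarrow> bool"
  for ar th ac n Es RE c where
  idE: "seqok ar th ac n RE \<Gamma> M \<Longrightarrow> i < n \<Longrightarrow> t \<in> ectx ar th i \<Gamma> \<Longrightarrow>
        (M, t) \<in> conv ac (\<Union>j<n. Es j) \<Longrightarrow> D ar th ac n Es RE c \<Gamma> M"
| cut: "c \<Longrightarrow> seqok ar th ac n RE \<Gamma> T \<Longrightarrow> D ar th ac n Es RE c \<Gamma> M \<Longrightarrow>
        D ar th ac n Es RE c (insert M \<Gamma>) T \<Longrightarrow> D ar th ac n Es RE c \<Gamma> T"
| pL: "seqok ar th ac n RE (insert (Pair M N) \<Gamma>) T \<Longrightarrow>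
        D ar th ac n Es RE c ({Pair M N, M, N} \<union> \<Gamma>) T \<Longrightarrow>
        D ar th ac n Es RE c (insert (Pair M N) \<Gamma>) T"
| pR: "seqok ar th ac n RE \<Gamma> (Pair M N) \<Longrightarrow> D ar th ac n Es RE c \<Gamma> M \<Longrightarrow>
        D ar th ac n Es RE c \<Gamma> N \<Longrightarrow> D ar th ac n Es RE c \<Gamma> (Pair M N)"
| eL: "seqok ar th ac n RE (insert (Enc M K) \<Gamma>) N \<Longrightarrow>
        D ar th ac n Es RE c (insert (Enc M K) \<Gamma>) K \<Longrightarrow>
        D ar th ac n Es RE c ({Enc M K, M, K} \<union> \<Gamma>) N \<Longrightarrow>
        D ar th ac n Es RE c (insert (Enc M K) \<Gamma>) N"
| eR: "seqok ar th ac n RE \<Gamma> (Enc M K) \<Longrightarrow> D ar th ac n Es RE c \<Gamma> M \<Longrightarrow>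
        D ar th ac n Es RE c \<Gamma> K \<Longrightarrow> D ar th ac n Es RE c \<Gamma> (Enc M K)"
| signL: "seqok ar th ac n RE ({Sign M K, Pub L} \<union> \<Gamma>) N \<Longrightarrow> (K, L) \<in> aceq ac \<Longrightarrow>
        D ar th ac n Es RE c ({Sign M K, Pub L, M} \<union> \<Gamma>) N \<Longrightarrow>
        D ar th ac n Es RE c ({Sign M K, Pub L} \<union> \<Gamma>) N"
| signR: "seqok ar th ac n RE \<Gamma> (Sign M K) \<Longrightarrow> D ar th ac n Es RE c \<Gamma> M \<Longrightarrow>
        D ar th ac n Es RE c \<Gamma> K \<Longrightarrow> D ar th ac n Es RE c \<Gamma> (Sign M K)"
| blindL1: "seqok ar th ac n RE (insert (Blind M K) \<Gamma>) N \<Longrightarrow>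
        D ar th ac n Es RE c (insert (Blind M K) \<Gamma>) K \<Longrightarrow>
        D ar th ac n Es RE c ({Blind M K, M, K} \<union> \<Gamma>) N \<Longrightarrow>
        D ar th ac n Es RE c (insert (Blind M K) \<Gamma>) N"
| blindR: "seqok ar th ac n RE \<Gamma> (Blind M K) \<Longrightarrow> D ar th ac n Es RE c \<Gamma> M \<Longrightarrow>
        D ar th ac n Es RE c \<Gamma> K \<Longrightarrow> D ar th ac n Es RE c \<Gamma> (Blind M K)"
| blindL2: "seqok ar th ac n RE (insert (Sign (Blind M Rb) K) \<Gamma>) N \<Longrightarrow>
        D ar th ac n Es RE c (insert (Sign (Blind M Rb) K) \<Gamma>) Rb \<Longrightarrow>
        D ar th ac n Es RE c ({Sign (Blind M Rb) K, Sign M K, Rb} \<union> \<Gamma>) N \<Longrightarrow>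
        D ar th ac n Es RE c (insert (Sign (Blind M Rb) K) \<Gamma>) N"
| gs: "seqok ar th ac n RE \<Gamma> M \<Longrightarrow> guarded A \<Longrightarrow> (\<exists>t\<in>insert M \<Gamma>. A \<in> subterms t) \<Longrightarrow>
        D ar th ac n Es RE c \<Gamma> A \<Longrightarrow> D ar th ac n Es RE c (insert A \<Gamma>) M \<Longrightarrow>
        D ar th ac n Es RE c \<Gamma> M"
| cs: "seqok ar th ac n RE \<Gamma> M \<Longrightarrow> (\<exists>t\<in>insert M \<Gamma>. N \<in> cross_sub th t) \<Longrightarrow>
        D ar th ac n Es RE c \<Gamma> N \<Longrightarrow> D ar th ac n Es RE c (insert N \<Gamma>) M \<Longrightarrow>
        D ar th ac n Es RE c \<Gamma> M"

end

(* Cuts are eliminated by induction on the size of the cut term, then on the derivations of its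
   two premises.  The equational part is needed when the cut term M is used in an id step
   T ~ C[M, M_1, ..., M_k] for a theory E_i other than that of the head of M.  If M occurs modulo AC
   in the conclusion of the cut as a guarded or cross-theory subterm, the cut is an instance of gs or
   cs.  Otherwise M can be replaced by a fresh name z in C[M, ...] without changing T: as the
   signatures are disjoint, the operations of the theory of the head of M may be conjugated with the
   transposition of the classes of M and z, which gives another model of E, and evaluation in it sends
   M to z and fixes T and the M_j.  Finally z is replaced by some M_j, or disappears if there is none. *)

theory Submission
  imports Defs
begin

section \<open>Equational closures\<close>

text \<open>The obstacle is that \<open>RE\<close> is only known to be convergent: its rules may mix
  theories, so a foreign subterm cannot be abstracted along a rewrite sequence. The equations of
  each \<open>Es i\<close> are pure, so the argument is semantic, and normal forms turn equality in
  E back into AC equality. A transposition is used, and not the map from M to z, because conjugating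
  operations by a bijection preserves every equation they satisfy. An id step in the theory of the
  head of M needs no model when M was itself obtained by such a step: the two contexts compose. If M
  was obtained by an id step of another theory, the same model shows that M is AC-equal to a member
  of the context or to a foreign subterm of one, which settles that cut whatever its right premise
  is. gs and cs are themselves cuts with a side condition. When a cut is permuted past one of them,
  the condition may have been witnessed by M alone; then the subterm is M, and one premise suffices,
  or it is smaller than M, and the size induction removes the resulting cut.\<close>

definition ac_rules :: "('f \<Rightarrow> bool) \<Rightarrow> ('f pat \<times> 'f pat) set" where
  "ac_rules A = {(PF f [PV 0, PV 1], PF f [PV 1, PV 0]) | f. A f}
     \<union> {(PF f [PF f [PV 0, PV 1], PV 2], PF f [PV 0, PF f [PV 1, PV 2]]) | f. A f}"

text \<open>Equality modulo AC and equality modulo E are both instances, so closure under contexts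
  and under replacement of names is shown once for the two.\<close>

definition eqt :: "('f pat \<times> 'f pat) set \<Rightarrow> ('f trm \<times> 'f trm) set" where
  "eqt P = (ctxt_cl (rroot P \<union> (rroot P)\<inverse>))\<^sup>*"

lemma rroot_Un: "rroot (P \<union> Q) = rroot P \<union> rroot Q"
  by (auto simp: rroot_def)

lemma rroot_ac_rules: "rroot (ac_rules A) = acroot A"
proof
  show "rroot (ac_rules A) \<subseteq> acroot A"
    by (auto simp: rroot_def ac_rules_def acroot_def)
  have "(Fn f [a, b], Fn f [b, a]) \<in> rroot (ac_rules A)" if "A f" for f a b
    unfolding rroot_def ac_rules_def using that
    by (intro CollectI exI[of _ "\<lambda>x. if x = 0 then a else b"] exI[of _ "PF f [PV 0, PV 1]"]
        exI[of _ "PF f [PV 1, PV 0]"]) auto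
  moreover have "(Fn f [Fn f [a, b], c], Fn f [a, Fn f [b, c]]) \<in> rroot (ac_rules A)" if "A f" for f a b c
    unfolding rroot_def ac_rules_def using that
    by (intro CollectI exI[of _ "\<lambda>x. if x = 0 then a else if x = 1 then b else c"]
        exI[of _ "PF f [PF f [PV 0, PV 1], PV 2]"] exI[of _ "PF f [PV 0, PF f [PV 1, PV 2]]"]) auto
  ultimately show "acroot A \<subseteq> rroot (ac_rules A)"
    by (auto simp: acroot_def)
qed

lemma ctxt_cl_mono:
  assumes "(s, t) \<in> ctxt_cl S" and "S \<subseteq> S'"
  shows "(s, t) \<in> ctxt_cl S'"
  using assms by (induction) (auto intro: ctxt_cl.intros)

lemma ctxt_cl_Un: "ctxt_cl (S \<union> S') = ctxt_cl S \<union> ctxt_cl S'"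
proof
  have "(s, t) \<in> ctxt_cl S \<union> ctxt_cl S'" if "(s, t) \<in> ctxt_cl (S \<union> S')" for s t
    using that by induction (auto intro: ctxt_cl.intros)
  then show "ctxt_cl (S \<union> S') \<subseteq> ctxt_cl S \<union> ctxt_cl S'" by auto
qed (auto intro: ctxt_cl_mono)

lemma ctxt_cl_converse: "ctxt_cl (S\<inverse>) = (ctxt_cl S)\<inverse>"
proof -
  have *: "(t, s) \<in> ctxt_cl (S\<inverse>)" if "(s, t) \<in> ctxt_cl S" for s t and S :: "('f trm \<times> 'f trm) set"
    using that by induction (auto intro: ctxt_cl.intros)
  from *[of _ _ S] *[of _ _ "S\<inverse>"] show ?thesis by auto
qed

lemma conv_eqt: "conv A R = eqt (ac_rules A \<union> R)"
  by (auto simp: conv_def eqt_def rstep_def ac_step_def rroot_Un rroot_ac_rules ctxt_cl_Un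
      ctxt_cl_converse converse_Un intro!: arg_cong[where f = rtrancl])

lemma aceq_eqt: "aceq A = eqt (ac_rules A)"
  by (simp add: aceq_def eqt_def ac_step_def rroot_ac_rules ctxt_cl_Un ctxt_cl_converse)

lemma eqt_mono: "P \<subseteq> Q \<Longrightarrow> eqt P \<subseteq> eqt Q"
  unfolding eqt_def by (intro rtrancl_mono subrelI) (erule ctxt_cl_mono, auto simp: rroot_def)

lemma aceq_conv: "aceq A \<subseteq> conv A R"
  by (auto simp: conv_eqt aceq_eqt intro: eqt_mono[THEN subsetD, rotated])

lemma eqt_refl [simp]: "(t, t) \<in> eqt P"
  by (simp add: eqt_def)

lemma eqt_sym: "(s, t) \<in> eqt P \<Longrightarrow> (t, s) \<in> eqt P"
proof -
  have "sym (ctxt_cl (rroot P \<union> (rroot P)\<inverse>))"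
    by (simp add: ctxt_cl_Un ctxt_cl_converse sym_Un_converse)
  then show "(s, t) \<in> eqt P \<Longrightarrow> (t, s) \<in> eqt P"
    unfolding eqt_def by (blast dest: sym_rtrancl symD)
qed

lemma eqt_trans [trans]: "(s, t) \<in> eqt P \<Longrightarrow> (t, u) \<in> eqt P \<Longrightarrow> (s, u) \<in> eqt P"
  by (simp add: eqt_def)

text \<open>F stands for a one-hole context, described by the closure property that it has; this
  covers all constructors and argument positions at once.\<close>

lemma eqt_ctxt:
  assumes "(s, t) \<in> eqt P" and "\<And>S s t. (s, t) \<in> ctxt_cl S \<Longrightarrow> (F s, F t) \<in> ctxt_cl S"
  shows "(F s, F t) \<in> eqt P"
  using assms(1) unfolding eqt_def
proof (induction rule: rtrancl_induct)
  case (step t u)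
  from step(3) assms(2)[OF step(2)] show ?case by (rule rtrancl_into_rtrancl)
qed simp

lemma eqt_fn:
  assumes "list_all2 (\<lambda>x y. (x, y) \<in> eqt P) xs ys"
  shows "(Fn f xs, Fn f ys) \<in> eqt P"
proof -
  \<comment> \<open>The prefix collects the arguments that are already replaced.\<close>
  have "(Fn f (zs @ xs), Fn f (zs @ ys)) \<in> eqt P" for zs
    using assms
  proof (induction arbitrary: zs rule: list_all2_induct)
    case (Cons x xs y ys)
    have "(Fn f (zs @ x # xs), Fn f (zs @ y # xs)) \<in> eqt P"
      using Cons(1) by (rule eqt_ctxt[where F = "\<lambda>s. Fn f (zs @ s # xs)"]) (rule ctxt_cl.fn)
    also have "(Fn f (zs @ y # xs), Fn f (zs @ y # ys)) \<in> eqt P"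
      using Cons(3)[of "zs @ [y]"] by simp
    finally show ?case .
  qed simp
  from this[of "[]"] show ?thesis by simp
qed

lemma eqt_fn_map:
  "(\<And>t. t \<in> set ts \<Longrightarrow> (g t, h t) \<in> eqt P) \<Longrightarrow> (Fn f (map g ts), Fn f (map h ts)) \<in> eqt P"
  by (rule eqt_fn) (simp add: list_all2_conv_all_nth)

text \<open>Contexts of one theory compose: each hole is filled with a context over the new
  set.\<close>

lemma ectx_eqt:
  assumes "t \<in> ectx ar th i \<Gamma>" and "\<And>x. x \<in> \<Gamma> \<Longrightarrow> \<exists>y\<in>ectx ar th i \<Delta>. (x, y) \<in> eqt P"
  shows "\<exists>t'\<in>ectx ar th i \<Delta>. (t, t') \<in> eqt P"
  using assms(1)
proof induction
  case (app f ts)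
  then obtain g where g: "\<And>t. t \<in> set ts \<Longrightarrow> g t \<in> ectx ar th i \<Delta> \<and> (t, g t) \<in> eqt P"
    by metis
  have "(Fn f (map (\<lambda>t. t) ts), Fn f (map g ts)) \<in> eqt P"
    by (rule eqt_fn_map) (use g in blast)
  moreover have "Fn f (map g ts) \<in> ectx ar th i \<Delta>"
    by (rule ectx.app) (use app g in auto)
  ultimately show ?case by auto
qed (use assms(2) in blast)

section \<open>Replacing names\<close>

text \<open>Patterns contain no names, so every rule is stable under this map and a fresh name can
  serve as a variable.\<close>

fun sub :: "nat \<Rightarrow> 'f trm \<Rightarrow> 'f trm \<Rightarrow> 'f trm" where
  "sub z u (Nm a) = (if a = z then u else Nm a)"
| "sub z u (Vr x) = Vr x"
| "sub z u (Pub M) = Pub (sub z u M)"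
| "sub z u (Sign M N) = Sign (sub z u M) (sub z u N)"
| "sub z u (Blind M N) = Blind (sub z u M) (sub z u N)"
| "sub z u (Pair M N) = Pair (sub z u M) (sub z u N)"
| "sub z u (Enc M N) = Enc (sub z u M) (sub z u N)"
| "sub z u (Fn f ts) = Fn f (map (sub z u) ts)"

lemma sub_inst: "sub z u (inst \<sigma> p) = inst (sub z u \<circ> \<sigma>) p"
  by (induction p) auto

lemma sub_ctxt_cl:
  assumes "(s, t) \<in> ctxt_cl S" and "\<And>a b. (a, b) \<in> S \<Longrightarrow> (sub z u a, sub z u b) \<in> S"
  shows "(sub z u s, sub z u t) \<in> ctxt_cl S"
  using assms(1) by induction (auto intro: ctxt_cl.intros assms(2))

lemma sub_rroot: "(a, b) \<in> rroot P \<Longrightarrow> (sub z u a, sub z u b) \<in> rroot P"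
  unfolding rroot_def by (force simp: sub_inst)

lemma sub_eqt: "(s, t) \<in> eqt P \<Longrightarrow> (sub z u s, sub z u t) \<in> eqt P"
  unfolding eqt_def
proof (induction rule: rtrancl_induct)
  case (step y w)
  have "(sub z u y, sub z u w) \<in> ctxt_cl (rroot P \<union> (rroot P)\<inverse>)"
    by (rule sub_ctxt_cl[OF step(2)]) (auto intro: sub_rroot)
  with step(3) show ?case by (rule rtrancl_into_rtrancl)
qed simp

lemma sub_rmod:
  assumes "(s, t) \<in> rmod A R" shows "(sub z u s, sub z u t) \<in> rmod A R"
proof -
  from assms obtain a b where "(s, a) \<in> aceq A" "(a, b) \<in> rstep R" "(b, t) \<in> aceq A"
    by (auto simp: rmod_def)
  then have "(sub z u s, sub z u a) \<in> aceq A" "(sub z u a, sub z u b) \<in> rstep R"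
      "(sub z u b, sub z u t) \<in> aceq A"
    by (auto simp: aceq_eqt rstep_def intro: sub_eqt sub_ctxt_cl sub_rroot)
  then show ?thesis by (auto simp: rmod_def)
qed

lemma sub_fresh: "Nm z \<notin> subterms t \<Longrightarrow> sub z u t = t"
  by (induction t) (auto intro: map_idI)

lemma subterms_refl [simp]: "t \<in> subterms t"
  by (cases t) auto

lemma subterms_trans: "s \<in> subterms t \<Longrightarrow> subterms s \<subseteq> subterms t"
  by (induction t) auto

lemma finite_subterms: "finite (subterms t)"
  by (induction t) auto

lemma fresh_name:
  assumes "finite \<Gamma>" shows "\<exists>z. \<forall>t\<in>\<Gamma>. Nm z \<notin> subterms t"
proof -
  have "finite (Nm -` (\<Union>t\<in>\<Gamma>. subterms t))"
    using assms by (intro finite_vimageI) (auto simp: finite_subterms inj_def)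
  then obtain z where "z \<notin> Nm -` (\<Union>t\<in>\<Gamma>. subterms t)"
    using ex_new_if_finite infinite_UNIV_nat by blast
  then show ?thesis by auto
qed

lemma ectx_sub:
  "t \<in> ectx ar th i \<Gamma> \<Longrightarrow> sub z u t \<in> ectx ar th i (sub z u ` \<Gamma>)"
  by (induction rule: ectx.induct) (auto intro!: ectx.app intro: ectx.hole)

lemma ectx_mono: "t \<in> ectx ar th i \<Gamma> \<Longrightarrow> \<Gamma> \<subseteq> \<Delta> \<Longrightarrow> t \<in> ectx ar th i \<Delta>"
  by (induction rule: ectx.induct) (auto intro: ectx.intros)

section \<open>Invariants of equality modulo AC\<close>

lemma subterm_size: "s \<in> subterms t \<Longrightarrow> s = t \<or> size s < size t"
proof (induction t)
  case (Fn f ts)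
  have "size t < size (Fn f ts)" if "t \<in> set ts" for t
    using size_list_estimation'[OF that order_refl, of size] by simp
  with Fn show ?case by fastforce
qed fastforce+

inductive_cases ctxt_cl_cases: "(Nm a, t) \<in> ctxt_cl S" "(Vr a, t) \<in> ctxt_cl S" "(Pub a, t) \<in> ctxt_cl S"
  "(Sign a b, t) \<in> ctxt_cl S" "(Blind a b, t) \<in> ctxt_cl S" "(Pair a b, t) \<in> ctxt_cl S"
  "(Enc a b, t) \<in> ctxt_cl S" "(Fn f ts, t) \<in> ctxt_cl S"

lemma aceq_induct [consumes 1, case_names refl step]:
  assumes "(s, t) \<in> aceq A" and "P s"
    and "\<And>t t'. (s, t) \<in> aceq A \<Longrightarrow> P t \<Longrightarrow> (t, t') \<in> ctxt_cl (acroot A \<union> (acroot A)\<inverse>) \<Longrightarrow> P t'"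
  shows "P t"
proof -
  have eq: "aceq A = (ctxt_cl (acroot A \<union> (acroot A)\<inverse>))\<^sup>*"
    by (simp add: aceq_eqt eqt_def rroot_ac_rules)
  have "(s, t) \<in> aceq A \<and> P t"
    using assms(1) unfolding eq
  proof (induction rule: rtrancl_induct)
    case (step t t')
    then show ?case using assms(3)[of t t'] by (auto simp: eq intro: rtrancl_into_rtrancl)
  qed (use assms(2) in simp)
  then show ?thesis ..
qed

lemma ac_step_aceq: "(s, t) \<in> ctxt_cl (acroot A \<union> (acroot A)\<inverse>) \<Longrightarrow> (s, t) \<in> aceq A"
  by (auto simp: aceq_eqt eqt_def rroot_ac_rules)

lemma aceq_refl [simp]: "(t, t) \<in> aceq A"
  by (simp add: aceq_eqt)

lemma aceq_sym: "(s, t) \<in> aceq A \<Longrightarrow> (t, s) \<in> aceq A"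
  unfolding aceq_eqt by (rule eqt_sym)

lemma aceq_trans [trans]: "(s, t) \<in> aceq A \<Longrightarrow> (t, u) \<in> aceq A \<Longrightarrow> (s, u) \<in> aceq A"
  unfolding aceq_eqt by (rule eqt_trans)

lemma bex_aceq: "a \<in> X \<Longrightarrow> \<exists>b\<in>X. (a, b) \<in> aceq A"
  by (rule bexI[of _ a]) simp_all

lemma aceq_step: "(s, t) \<in> aceq A \<Longrightarrow> (t, t') \<in> ctxt_cl (acroot A \<union> (acroot A)\<inverse>) \<Longrightarrow> (s, t') \<in> aceq A"
  by (rule aceq_trans[OF _ ac_step_aceq])

text \<open>Root AC steps relate only terms headed by equational symbols, which makes names and
  constructors rigid modulo AC.\<close>

lemma acroot_Fn: "(s, t) \<in> acroot A \<union> (acroot A)\<inverse> \<Longrightarrow> \<exists>f ts us. s = Fn f ts \<and> t = Fn f us"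
  by (auto simp: acroot_def)

lemma aceq_Nm: "(Nm a, t) \<in> aceq A \<Longrightarrow> t = Nm a"
  by (induction rule: aceq_induct) (auto elim!: ctxt_cl_cases dest!: acroot_Fn)

lemma aceq_Pub: "(Pub a, t) \<in> aceq A \<Longrightarrow> \<exists>a'. t = Pub a' \<and> (a, a') \<in> aceq A"
  by (induction rule: aceq_induct)
    (auto elim!: ctxt_cl_cases dest!: acroot_Fn intro: aceq_step)

lemma aceq_Pair: "(Pair a b, t) \<in> aceq A \<Longrightarrow> \<exists>a' b'. t = Pair a' b' \<and> (a, a') \<in> aceq A \<and> (b, b') \<in> aceq A"
  by (induction rule: aceq_induct)
    (auto elim!: ctxt_cl_cases dest!: acroot_Fn intro: aceq_step)

lemma aceq_Enc: "(Enc a b, t) \<in> aceq A \<Longrightarrow> \<exists>a' b'. t = Enc a' b' \<and> (a, a') \<in> aceq A \<and> (b, b') \<in> aceq A"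
  by (induction rule: aceq_induct)
    (auto elim!: ctxt_cl_cases dest!: acroot_Fn intro: aceq_step)

lemma aceq_Sign: "(Sign a b, t) \<in> aceq A \<Longrightarrow> \<exists>a' b'. t = Sign a' b' \<and> (a, a') \<in> aceq A \<and> (b, b') \<in> aceq A"
  by (induction rule: aceq_induct)
    (auto elim!: ctxt_cl_cases dest!: acroot_Fn intro: aceq_step)

lemma aceq_Blind: "(Blind a b, t) \<in> aceq A \<Longrightarrow> \<exists>a' b'. t = Blind a' b' \<and> (a, a') \<in> aceq A \<and> (b, b') \<in> aceq A"
  by (induction rule: aceq_induct)
    (auto elim!: ctxt_cl_cases dest!: acroot_Fn intro: aceq_step)

text \<open>Guarded terms form a layer of their own, \<open>None\<close>, so a guarded cut term
  needs no separate model below.\<close>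

fun layer :: "('f \<Rightarrow> nat) \<Rightarrow> 'f trm \<Rightarrow> nat option" where
  "layer th (Fn f ts) = Some (th f)"
| "layer th _ = None"

lemma guarded_layer: "guarded t \<longleftrightarrow> layer th t = None"
  by (cases t) auto

fun aliens :: "('f \<Rightarrow> nat) \<Rightarrow> 'f trm \<Rightarrow> 'f trm set" where
  "aliens th (Fn f ts) = {N \<in> set ts. layer th N \<noteq> Some (th f)}"
| "aliens th _ = {}"

text \<open>In this form the set is a union over subterms, from which its recursive equations can be
  read off.\<close>

lemma cross_sub_aliens: "cross_sub th t = {N \<in> (\<Union>s\<in>subterms t. aliens th s). \<not> guarded N}"
proof (intro equalityI subsetI)
  fix N assume "N \<in> cross_sub th t"
  then obtain f ts g us where "Fn f ts \<in> subterms t" "N \<in> set ts" "N = Fn g us" "th g \<noteq> th f"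
    unfolding cross_sub_def by blast
  then show "N \<in> {N \<in> (\<Union>s\<in>subterms t. aliens th s). \<not> guarded N}"
    by (intro CollectI conjI UN_I[of "Fn f ts"]) auto
next
  fix N assume "N \<in> {N \<in> (\<Union>s\<in>subterms t. aliens th s). \<not> guarded N}"
  then obtain s where s: "s \<in> subterms t" "N \<in> aliens th s" "\<not> guarded N" by auto
  moreover from this obtain f ts where "s = Fn f ts" by (cases s) auto
  moreover from s obtain g us where "N = Fn g us" by (cases N) auto
  ultimately show "N \<in> cross_sub th t" unfolding cross_sub_def by auto
qed

lemma cross_sub_simps [simp]:
  "cross_sub th (Nm a) = {}"
  "cross_sub th (Vr a) = {}"
  "cross_sub th (Pub s) = cross_sub th s"
  "cross_sub th (Sign s t) = cross_sub th s \<union> cross_sub th t"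
  "cross_sub th (Blind s t) = cross_sub th s \<union> cross_sub th t"
  "cross_sub th (Pair s t) = cross_sub th s \<union> cross_sub th t"
  "cross_sub th (Enc s t) = cross_sub th s \<union> cross_sub th t"
  "cross_sub th (Fn f ts) = {N \<in> set ts. \<not> guarded N \<and> layer th N \<noteq> Some (th f)} \<union> (\<Union>t\<in>set ts. cross_sub th t)"
  unfolding cross_sub_aliens by auto

lemma cross_sub_subterms: "cross_sub th t \<subseteq> subterms t"
  by (induction t) auto

lemma ac_step_layer:
  "(s, t) \<in> ctxt_cl (acroot A \<union> (acroot A)\<inverse>) \<Longrightarrow> layer th s = layer th t"
  by (induction rule: ctxt_cl.induct) (auto simp: acroot_def)

lemma aceq_layer: "(s, t) \<in> aceq A \<Longrightarrow> layer th s = layer th t"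
  by (induction rule: aceq_induct) (auto dest: ac_step_layer)

lemma aceq_guarded: "(s, t) \<in> aceq A \<Longrightarrow> guarded s = guarded t"
  using aceq_layer[of s t A "\<lambda>_. 0"] by (simp add: guarded_layer[where th = "\<lambda>_. 0"])

lemma aceq_size: "(s, t) \<in> aceq A \<Longrightarrow> size s = size t"
proof (induction rule: aceq_induct)
  case (step t t')
  from step.hyps(2) have "size t = size t'"
    by (induction rule: ctxt_cl.induct) (auto simp: acroot_def)
  with step show ?case by simp
qed simp

lemma aceq_wf: "(s, t) \<in> aceq A \<Longrightarrow> wf_trm ar th n s \<Longrightarrow> wf_trm ar th n t"
proof (induction rule: aceq_induct)
  case (step t t')
  from step.hyps(2) have "wf_trm ar th n t \<Longrightarrow> wf_trm ar th n t'"
    by (induction rule: ctxt_cl.induct) (auto simp: acroot_def)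
  with step show ?case by simp
qed simp

text \<open>Associativity destroys \<open>Fn f [a, b]\<close> and creates
  \<open>Fn f [b, c]\<close>, but both are unguarded; the guarded subterms of the two sides of an
  axiom coincide. This transports the side condition of gs.\<close>

lemma aceq_guarded_subterm:
  assumes "(s, t) \<in> aceq A" "a \<in> subterms s" "guarded a"
  shows "\<exists>a'\<in>subterms t. guarded a' \<and> (a, a') \<in> aceq A"
  using assms
proof (induction arbitrary: a rule: aceq_induct)
  case (step t t')
  from step.hyps(2) have "\<forall>a\<in>subterms t. guarded a \<longrightarrow> (\<exists>a'\<in>subterms t'. guarded a' \<and> (a, a') \<in> aceq A)"
  proof (induction rule: ctxt_cl.induct)
    case (base s t)
    then have "{a \<in> subterms s. guarded a} = {a \<in> subterms t. guarded a}"
      by (auto simp: acroot_def)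
    then show ?case by (metis (mono_tags, lifting) aceq_refl mem_Collect_eq)
  next
    case (pub s t)
    then have "(Pub s, Pub t) \<in> aceq A" by (intro ac_step_aceq ctxt_cl.pub)
    with pub show ?case by (auto intro: aceq_refl)
  next
    case (sign1 s t u)
    then have "(Sign s u, Sign t u) \<in> aceq A" by (intro ac_step_aceq ctxt_cl.sign1)
    with sign1 show ?case by (auto intro: aceq_refl)
  next
    case (sign2 s t u)
    then have "(Sign u s, Sign u t) \<in> aceq A" by (intro ac_step_aceq ctxt_cl.sign2)
    with sign2 show ?case by (auto intro: aceq_refl)
  next
    case (blind1 s t u)
    then have "(Blind s u, Blind t u) \<in> aceq A" by (intro ac_step_aceq ctxt_cl.blind1)
    with blind1 show ?case by (auto intro: aceq_refl)
  next
    case (blind2 s t u)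
    then have "(Blind u s, Blind u t) \<in> aceq A" by (intro ac_step_aceq ctxt_cl.blind2)
    with blind2 show ?case by (auto intro: aceq_refl)
  next
    case (pair1 s t u)
    then have "(Pair s u, Pair t u) \<in> aceq A" by (intro ac_step_aceq ctxt_cl.pair1)
    with pair1 show ?case by (auto intro: aceq_refl)
  next
    case (pair2 s t u)
    then have "(Pair u s, Pair u t) \<in> aceq A" by (intro ac_step_aceq ctxt_cl.pair2)
    with pair2 show ?case by (auto intro: aceq_refl)
  next
    case (enc1 s t u)
    then have "(Enc s u, Enc t u) \<in> aceq A" by (intro ac_step_aceq ctxt_cl.enc1)
    with enc1 show ?case by (auto intro: aceq_refl)
  next
    case (enc2 s t u)
    then have "(Enc u s, Enc u t) \<in> aceq A" by (intro ac_step_aceq ctxt_cl.enc2)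
    with enc2 show ?case by (auto intro: aceq_refl)
  next
    case (fn s t f xs ys)
    then show ?case by (auto intro: aceq_refl)
  qed
  with step show ?case by (meson aceq_trans)
qed auto

text \<open>The terms that associativity creates or destroys sit below a symbol of their own theory,
  so they are not cross-theory at that place. This transports the side condition of cs.\<close>

lemma aceq_cross_sub:
  assumes "(s, t) \<in> aceq A" "a \<in> cross_sub th s"
  shows "\<exists>a'\<in>cross_sub th t. (a, a') \<in> aceq A"
  using assms
proof (induction arbitrary: a rule: aceq_induct)
  case (step t t')
  from step.hyps(2) have "\<forall>a\<in>cross_sub th t. \<exists>a'\<in>cross_sub th t'. (a, a') \<in> aceq A"
  proof (induction rule: ctxt_cl.induct)
    case (base s t)
    then have "cross_sub th s = cross_sub th t"
      by (auto simp: acroot_def)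
    then show ?case by (metis aceq_refl)
  next
    case (fn s t f xs ys)
    then have st: "(s, t) \<in> aceq A" by (rule_tac ac_step_aceq)
    show ?case
    proof
      fix a assume "a \<in> cross_sub th (Fn f (xs @ s # ys))"
      then consider "a \<in> cross_sub th (Fn f (xs @ t # ys))" | "a \<in> cross_sub th s"
        | "a = s" "\<not> guarded s" "layer th s \<noteq> Some (th f)"
        by auto
      then show "\<exists>a'\<in>cross_sub th (Fn f (xs @ t # ys)). (a, a') \<in> aceq A"
      proof cases
        case 2
        with fn.IH obtain a' where "a' \<in> cross_sub th t" "(a, a') \<in> aceq A" by blast
        then show ?thesis by auto
      next
        case 3
        then have "t \<in> cross_sub th (Fn f (xs @ t # ys))"
          using aceq_guarded[OF st] aceq_layer[OF st, of th] by simp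
        with 3 st show ?thesis by blast
      qed (use aceq_refl in blast)
    qed
  qed (simp_all add: ball_Un bex_Un, (blast intro: bex_aceq)+)
  with step show ?case by (meson aceq_trans)
qed (blast intro: bex_aceq)

lemma aceq_nf: "(s, t) \<in> aceq A \<Longrightarrow> nf_mod A R s \<Longrightarrow> nf_mod A R t"
  unfolding nf_mod_def rmod_def by (blast intro: aceq_trans)

lemma nf_ctxt:
  assumes "nf_mod A R (F t)" and F: "\<And>S s t. (s, t) \<in> ctxt_cl S \<Longrightarrow> (F s, F t) \<in> ctxt_cl S"
  shows "nf_mod A R t"
proof -
  have "(F t, F u) \<in> rmod A R" if "(t, u) \<in> rmod A R" for u
  proof -
    from that obtain a b where tab: "(t, a) \<in> aceq A" "(a, b) \<in> rstep R" "(b, u) \<in> aceq A"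
      by (auto simp: rmod_def)
    have "(F t, F a) \<in> aceq A" using tab(1) F unfolding aceq_eqt by (rule eqt_ctxt)
    moreover have "(F a, F b) \<in> rstep R" using tab(2) unfolding rstep_def by (rule F)
    moreover have "(F b, F u) \<in> aceq A" using tab(3) F unfolding aceq_eqt by (rule eqt_ctxt)
    ultimately show ?thesis by (auto simp: rmod_def)
  qed
  with assms(1) show ?thesis by (auto simp: nf_mod_def)
qed

lemma nf_arg:
  assumes "nf_mod A R (Fn f ts)" "t \<in> set ts" shows "nf_mod A R t"
proof -
  obtain xs ys where "ts = xs @ t # ys" using assms(2) by (auto dest: split_list)
  with assms(1) have "nf_mod A R (Fn f (xs @ t # ys))" by simp
  then show ?thesis
    by (rule nf_ctxt[where F = "\<lambda>t. Fn f (xs @ t # ys)"]) (rule ctxt_cl.fn)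
qed

section \<open>Recognising foreign subterms\<close>

fun pure :: "('f \<Rightarrow> nat) \<Rightarrow> nat \<Rightarrow> 'f pat \<Rightarrow> bool" where
  "pure th i (PV x) = True"
| "pure th i (PF f ps) = (th f = i \<and> (\<forall>p\<in>set ps. pure th i p))"

lemma pat_over_pure: "pat_over ar (\<lambda>f. th f = i) p \<Longrightarrow> pure th i p"
  by (induction p) auto

text \<open>It acts on classes but has to return terms, so u and v serve as representatives and it
  is an involution only modulo Q.\<close>

definition swap :: "('f trm \<times> 'f trm) set \<Rightarrow> 'f trm \<Rightarrow> 'f trm \<Rightarrow> 'f trm \<Rightarrow> 'f trm" where
  "swap Q u v x = (if (x, u) \<in> Q then v else if (x, v) \<in> Q then u else x)"

text \<open>A model of the combined theory on the terms modulo Q: the theory to which the head of u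
  belongs is interpreted by the term operations conjugated with the transposition of the classes of
  u and v, the other theories by the term operations, and guarded terms are constants.  As the
  signatures are disjoint, each theory still holds.\<close>

fun ev :: "('f \<Rightarrow> nat) \<Rightarrow> ('f trm \<times> 'f trm) set \<Rightarrow> 'f trm \<Rightarrow> 'f trm \<Rightarrow> 'f trm \<Rightarrow> 'f trm" where
  "ev th Q u v (Fn f ts) = (if layer th u = Some (th f)
     then swap Q u v (Fn f (map (\<lambda>t. swap Q u v (ev th Q u v t)) ts))
     else Fn f (map (ev th Q u v) ts))"
| "ev th Q u v t = (if layer th u = None then swap Q u v t else t)"

lemma ev_guarded: "guarded t \<Longrightarrow> ev th Q u v t = (if layer th u = None then swap Q u v t else t)"
  by (cases t) auto

text \<open>Unlike cross_sub, this set does not look below constructors, and it contains guarded terms.\<close>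

fun foreign :: "('f \<Rightarrow> nat) \<Rightarrow> 'f trm \<Rightarrow> 'f trm set" where
  "foreign th (Fn f ts) = {t \<in> set ts. layer th t \<noteq> Some (th f)} \<union> (\<Union>t\<in>set ts. foreign th t)"
| "foreign th _ = {}"

text \<open>The syntactic counterpart of \<open>ev\<close>: an occurrence of u at the root stays,
  and nothing changes below a constructor, where the model sees constants.\<close>

fun repl :: "('f \<Rightarrow> nat) \<Rightarrow> ('f trm \<times> 'f trm) set \<Rightarrow> 'f trm \<Rightarrow> 'f trm \<Rightarrow> 'f trm \<Rightarrow> 'f trm" where
  "repl th Q u v (Fn f ts) =
     Fn f (map (\<lambda>t. if layer th t \<noteq> Some (th f) \<and> (t, u) \<in> Q then v else repl th Q u v t) ts)"
| "repl th Q u v t = t"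

lemma foreign_subterm: "w \<in> foreign th t \<Longrightarrow> w \<in> subterms t \<and> size w < size t"
proof (induction t)
  case (Fn f ts)
  have "size t < size (Fn f ts)" if "t \<in> set ts" for t
    using size_list_estimation'[OF that order_refl, of size] by simp
  with Fn show ?case by fastforce
qed auto

text \<open>AC equality preserves size and foreign subterms are strictly smaller. Hence
  \<open>repl\<close> leaves every term in the AC class of u unchanged.\<close>

lemma foreign_not_aceq:
  assumes "(t, u) \<in> aceq A" "w \<in> foreign th t" shows "(w, u) \<notin> aceq A"
proof
  assume "(w, u) \<in> aceq A"
  with assms(1) have "size w = size t" by (simp add: aceq_size)
  with foreign_subterm[OF assms(2)] show False by simp
qed

lemma foreign_nf: "w \<in> foreign th t \<Longrightarrow> nf_mod A R t \<Longrightarrow> nf_mod A R w"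
  by (induction t) (auto intro: nf_arg)

lemma foreign_cross_sub: "w \<in> foreign th t \<Longrightarrow> \<not> guarded w \<Longrightarrow> w \<in> cross_sub th t"
  by (induction t) auto

lemma repl_id: "\<forall>w\<in>foreign th t. (w, u) \<notin> Q \<Longrightarrow> repl th Q u v t = t"
proof (induction t)
  case (Fn f ts)
  then have "repl th Q u v t = t" "layer th t = Some (th f) \<or> (t, u) \<notin> Q" if "t \<in> set ts" for t
    using that by auto
  then show ?case by (fastforce intro!: map_idI)
qed simp_all

lemma Nm_in_repl:
  "w \<in> foreign th t \<Longrightarrow> (w, u) \<in> Q \<Longrightarrow> Nm z \<in> subterms (repl th Q u (Nm z) t)"
proof (induction t)
  case (Fn f ts)
  then consider "w \<in> set ts" "layer th w \<noteq> Some (th f)" | t where "t \<in> set ts" "w \<in> foreign th t" by auto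
  then show ?case
  proof cases
    case 1
    with Fn(3) show ?thesis by auto
  next
    case 2
    with Fn have "Nm z \<in> subterms (repl th Q u (Nm z) t)" by blast
    with 2 show ?thesis by (auto intro!: bexI[of _ t])
  qed
qed auto

text \<open>The replaced subterms were only AC-equal to u, so t comes back up to AC and not
  literally.\<close>

lemma sub_repl:
  assumes "Nm z \<notin> subterms t"
  shows "(sub z u (repl th (aceq A) u (Nm z) t), t) \<in> aceq A"
  using assms
proof (induction t)
  case (Fn f ts)
  have "(Fn f (map (\<lambda>t. sub z u (if layer th t \<noteq> Some (th f) \<and> (t, u) \<in> aceq A then Nm z
      else repl th (aceq A) u (Nm z) t)) ts), Fn f (map (\<lambda>t. t) ts)) \<in> aceq A"
    unfolding aceq_eqt
    by (rule eqt_fn_map) (use Fn in \<open>auto simp: aceq_eqt[symmetric] intro: aceq_sym\<close>)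
  then show ?case by (simp add: comp_def)
qed (auto simp: sub_fresh)

text \<open>\<open>foreign\<close> collects from all depths; the subterms at which the top k-layer
  of t ends are among those kept by the filter. If none is left, t is a context without
  holes.\<close>

lemma ectx_foreign:
  "wf_trm ar th n t \<Longrightarrow> layer th t = Some k \<Longrightarrow>
   t \<in> ectx ar th k {w \<in> foreign th t. layer th w \<noteq> Some k}"
proof (induction t)
  case (Fn f ts)
  have k: "th f = k" using Fn.prems by simp
  have "t \<in> ectx ar th k {w \<in> foreign th (Fn f ts). layer th w \<noteq> Some k}" if t: "t \<in> set ts" for t
  proof (cases "layer th t = Some k")
    case True
    then have "t \<in> ectx ar th k {w \<in> foreign th t. layer th w \<noteq> Some k}"
      using Fn t by auto
    then show ?thesis by (rule ectx_mono) (use t in auto)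
  next
    case False
    then show ?thesis by (intro ectx.hole) (use t k in auto)
  qed
  then show ?case using Fn.prems by (intro ectx.app) auto
qed auto

section \<open>Normal forms of the combined theory\<close>

locale combination =
  fixes ar th :: "'f \<Rightarrow> nat" and ac :: "'f \<Rightarrow> bool" and n :: nat
    and Es :: "nat \<Rightarrow> ('f pat \<times> 'f pat) set" and RE :: "('f pat \<times> 'f pat) set"
  assumes Es_pure: "i < n \<Longrightarrow> (l, r) \<in> Es i \<Longrightarrow> pure th i l \<and> pure th i r"
    and RE_presents: "conv ac RE = conv ac (\<Union>i<n. Es i)"
    and RE_conv: "convergent_mod ac RE"
begin

abbreviation E where "E \<equiv> ac_rules ac \<union> (\<Union>i<n. Es i)"
abbreviation eqE (infix "\<approx>" 50) where "s \<approx> t \<equiv> (s, t) \<in> eqt E"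
abbreviation eqAC (infix "\<doteq>" 50) where "s \<doteq> t \<equiv> (s, t) \<in> aceq ac"
abbreviation nf where "nf \<equiv> nf_mod ac RE"

lemma AC_E: "s \<doteq> t \<Longrightarrow> s \<approx> t"
  using aceq_conv[of ac "\<Union>i<n. Es i"] unfolding conv_eqt by blast

text \<open>Disjointness of the signatures enters here: \<open>th\<close> is a function, and each
  axiom, the AC ones included, uses the symbols of one theory.\<close>

lemma E_pure: "(l, r) \<in> E \<Longrightarrow> \<exists>i. pure th i l \<and> pure th i r"
  by (auto simp: ac_rules_def dest: Es_pure)

lemma join:
  assumes "s \<approx> t" "nf t" shows "\<exists>s'. (s, s') \<in> (rmod ac RE)\<^sup>* \<and> s' \<doteq> t"
proof -
  have "(s, t) \<in> conv ac RE" using assms(1) unfolding RE_presents by (simp add: conv_eqt)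
  then obtain s' t' where "(s, s') \<in> (rmod ac RE)\<^sup>*" "(t, t') \<in> (rmod ac RE)\<^sup>*" "s' \<doteq> t'"
    using RE_conv unfolding convergent_mod_def by blast
  moreover from this(2) assms(2) have "t = t'"
    by (auto simp: nf_mod_def elim: converse_rtranclE)
  ultimately show ?thesis by blast
qed

lemma nf_unique: "s \<approx> t \<Longrightarrow> nf s \<Longrightarrow> nf t \<Longrightarrow> s \<doteq> t"
  using join[of s t] by (auto simp: nf_mod_def elim: converse_rtranclE)

text \<open>A name can only be rewritten by a rule whose left side is a bare variable. Such a rule
  would rewrite every term, so the existence of one normal form t excludes it.\<close>

lemma nf_Nm: 
  assumes "nf t" shows "nf (Nm z)"
proof (rule ccontr)
  assume "\<not> nf (Nm z)"
  then obtain b where "(Nm z, b) \<in> rstep RE"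
    by (auto simp: nf_mod_def rmod_def dest!: aceq_Nm)
  then obtain \<sigma> l r where "(l, r) \<in> RE" "inst \<sigma> l = Nm z"
    unfolding rstep_def by (auto elim!: ctxt_cl_cases simp: rroot_def)
  then have "(inst (\<lambda>_. t) l, inst (\<lambda>_. t) r) \<in> rstep RE" "inst (\<lambda>_. t) l = t"
    by (auto simp: rstep_def rroot_def intro!: ctxt_cl.base) (cases l; simp)
  then have "(t, inst (\<lambda>_. t) r) \<in> rmod ac RE"
    unfolding rmod_def by (metis aceq_refl relcomp.relcompI)
  with assms show False by (auto simp: nf_mod_def)
qed

lemma nf_not_Nm: "nf t \<Longrightarrow> t \<noteq> Nm z \<Longrightarrow> \<not> t \<approx> Nm z"
  using nf_unique[of t "Nm z"] nf_Nm[of t z] aceq_Nm[of z t] aceq_sym[of t "Nm z"] by blast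

section \<open>Evaluation in the transposition model for a normal term u and a fresh name z\<close>

context
  fixes u :: "'f trm" and z :: nat
  assumes nf_u: "nf u" and fresh_u: "Nm z \<notin> subterms u"
begin

abbreviation sw where "sw \<equiv> swap (eqt E) u (Nm z)"
abbreviation eval where "eval \<equiv> ev th (eqt E) u (Nm z)"
abbreviation rp where "rp \<equiv> repl th (aceq ac) u (Nm z)"

lemma u_not_Nm: "\<not> u \<approx> Nm z"
  using nf_not_Nm[OF nf_u, of z] fresh_u subterms_refl[of u] by metis

lemma sw_cong: "s \<approx> t \<Longrightarrow> sw s \<approx> sw t"
  unfolding swap_def by (auto intro: eqt_trans eqt_sym)

lemma sw_sw: "sw (sw t) \<approx> t"
  using u_not_Nm unfolding swap_def by (auto intro: eqt_trans eqt_sym)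

lemma sw_id: "\<not> t \<approx> u \<Longrightarrow> \<not> t \<approx> Nm z \<Longrightarrow> sw t = t"
  unfolding swap_def by auto

lemma sw_u: "t \<approx> u \<Longrightarrow> sw t = Nm z"
  unfolding swap_def by auto

lemma eval_inst:
  assumes "pure th i p" "layer th u \<noteq> Some i" shows "eval (inst \<sigma> p) = inst (eval \<circ> \<sigma>) p"
  using assms by (induction p) auto

text \<open>The swap around each inner symbol meets the swap applied to it as an argument, and the
  two cancel; one swap is left at the root and one at each variable.\<close>

lemma eval_inst_swap:
  assumes "pure th i p" "layer th u = Some i" shows "eval (inst \<sigma> p) \<approx> sw (inst (sw \<circ> eval \<circ> \<sigma>) p)"
  using assms
proof (induction p)
  case (PV x)
  then show ?case by (auto intro: eqt_sym sw_sw)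
next
  case (PF f ps)
  have "sw (eval (inst \<sigma> p)) \<approx> inst (sw \<circ> eval \<circ> \<sigma>) p" if "p \<in> set ps" for p
  proof -
    have "eval (inst \<sigma> p) \<approx> sw (inst (sw \<circ> eval \<circ> \<sigma>) p)" using that PF.IH[OF that] PF.prems by (simp add: comp_def)
    from eqt_trans[OF sw_cong[OF this] sw_sw] show ?thesis .
  qed
  then have "Fn f (map (\<lambda>p. sw (eval (inst \<sigma> p))) ps) \<approx> Fn f (map (inst (sw \<circ> eval \<circ> \<sigma>)) ps)"
    by (rule eqt_fn_map)
  with PF.prems show ?case by (auto intro: sw_cong simp: comp_def)
qed

lemma inst_rule: "(l, r) \<in> E \<Longrightarrow> inst \<sigma> l \<approx> inst \<sigma> r"
  unfolding eqt_def by (intro r_into_rtrancl ctxt_cl.base UnI1) (auto simp: rroot_def)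

lemma eval_rroot:
  assumes "(s, t) \<in> rroot E" shows "eval s \<approx> eval t"
proof -
  from assms obtain \<sigma> l r where lr: "(l, r) \<in> E" "s = inst \<sigma> l" "t = inst \<sigma> r"
    by (auto simp: rroot_def)
  obtain i where i: "pure th i l" "pure th i r" using E_pure[OF lr(1)] by blast
  show ?thesis
  proof (cases "layer th u = Some i")
    case True
    have "eval s \<approx> sw (inst (sw \<circ> eval \<circ> \<sigma>) l)" using eval_inst_swap i True lr by blast
    also have "sw (inst (sw \<circ> eval \<circ> \<sigma>) l) \<approx> sw (inst (sw \<circ> eval \<circ> \<sigma>) r)"
      by (intro sw_cong inst_rule lr)
    also have "sw (inst (sw \<circ> eval \<circ> \<sigma>) r) \<approx> eval t"
      using eval_inst_swap i True lr by (blast intro: eqt_sym)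
    finally show ?thesis .
  next
    case False
    then show ?thesis using eval_inst i lr inst_rule by simp
  qed
qed

lemma eval_step:
  assumes "(s, t) \<in> ctxt_cl (rroot E \<union> (rroot E)\<inverse>)" shows "eval s \<approx> eval t"
proof -
  \<comment> \<open>A step below a constructor keeps the head guarded. Guarded terms are evaluated
    as constants, so no induction hypothesis is needed, only congruence of the swap.\<close>
  have guarded: "eval s' \<approx> eval t'"
    if "(s', t') \<in> ctxt_cl (rroot E \<union> (rroot E)\<inverse>)" "guarded s'" "guarded t'" for s' t'
  proof -
    have "s' \<approx> t'" using that(1) by (auto simp: eqt_def)
    with that show ?thesis by (simp add: ev_guarded sw_cong)
  qed
  from assms show ?thesis
  proof induction
    case (base s t)
    then show ?case using eval_rroot by (auto intro: eqt_sym)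
  next
    case (fn s t f xs ys)
    have "Fn f (map eval xs @ eval s # map eval ys) \<approx> Fn f (map eval xs @ eval t # map eval ys)"
      using fn.IH by (rule eqt_ctxt[where F = "\<lambda>s. Fn f (map eval xs @ s # map eval ys)"]) (rule ctxt_cl.fn)
    moreover have "Fn f (map (sw \<circ> eval) xs @ sw (eval s) # map (sw \<circ> eval) ys)
        \<approx> Fn f (map (sw \<circ> eval) xs @ sw (eval t) # map (sw \<circ> eval) ys)"
      using sw_cong[OF fn.IH]
      by (rule eqt_ctxt[where F = "\<lambda>s. Fn f (map (sw \<circ> eval) xs @ s # map (sw \<circ> eval) ys)"]) (rule ctxt_cl.fn)
    ultimately show ?case by (auto simp: comp_def intro: sw_cong)
  qed (rule guarded, erule ctxt_cl.intros, simp, simp)+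
qed

lemma eval_cong: "s \<approx> t \<Longrightarrow> eval s \<approx> eval t"
proof -
  have "eval s \<approx> eval t" if "(s, t) \<in> (ctxt_cl (rroot E \<union> (rroot E)\<inverse>))\<^sup>*"
    using that by (induction rule: rtrancl_induct) (auto intro: eqt_trans eval_step)
  then show "s \<approx> t \<Longrightarrow> eval s \<approx> eval t" by (simp add: eqt_def)
qed

text \<open>Putting u back for z turns both alternatives into an equality of t with u in E, and both
  are normal.\<close>

lemma rp_class:
  assumes "nf t" "Nm z \<notin> subterms t" "rp t \<approx> u \<or> rp t \<approx> Nm z" shows "t \<doteq> u"
proof -
  have "sub z u (rp t) \<approx> u"
    using assms(3) sub_eqt[of "rp t" _ E z u] by (force simp: sub_fresh[OF fresh_u])
  then have "t \<approx> u"
    by (rule eqt_trans[OF eqt_sym[OF AC_E[OF sub_repl[OF assms(2)]]]])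
  then show ?thesis using nf_unique assms nf_u by blast
qed

text \<open>Between adjacent symbols of the theory of u two swaps cancel. An uncancelled swap sits
  at a border of that theory, and by \<open>rp_class\<close> it can move only terms AC-equal to u,
  which become z. At the root the outer swap remains.\<close>

lemma eval_repl:
  assumes "nf t" "Nm z \<notin> subterms t"
  shows "eval t \<approx> (if layer th t = layer th u then sw (rp t) else rp t)"
  using assms
proof (induction t)
  case (Fn f ts)
  have IH: "eval t \<approx> (if layer th t = layer th u then sw (rp t) else rp t)" 
    "nf t" "Nm z \<notin> subterms t" if t: "t \<in> set ts" for t
  proof -
    show "nf t" using nf_arg[OF Fn.prems(1) t] .
    moreover show "Nm z \<notin> subterms t" using Fn.prems(2) t by auto
    ultimately show "eval t \<approx> (if layer th t = layer th u then sw (rp t) else rp t)"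
      by (rule Fn.IH[OF t])
  qed
  have sw_rp: "sw (rp t) = rp t" if "t \<in> set ts" "\<not> t \<doteq> u" for t
    using rp_class[OF IH(2,3)] that by (blast intro: sw_id)
  show ?case
  proof (cases "layer th u = Some (th f)")
    case True
    have "sw (eval t) \<approx> (if layer th t \<noteq> Some (th f) \<and> t \<doteq> u then Nm z else rp t)" if "t \<in> set ts" for t
    proof -
      have "sw (eval t) \<approx> rp t"
      proof (cases "layer th t = layer th u")
        case True
        with sw_cong[OF IH(1)[OF that]] show ?thesis by (auto intro: eqt_trans[OF _ sw_sw])
      next
        case False
        then have "\<not> t \<doteq> u" by (blast dest: aceq_layer)
        with sw_cong[OF IH(1)[OF that]] sw_rp[OF that] False show ?thesis by simp
      qed
      with aceq_layer[of t u ac th] True show ?thesis by auto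
    qed
    then have "Fn f (map (\<lambda>t. sw (eval t)) ts) \<approx> rp (Fn f ts)"
      unfolding repl.simps by (rule eqt_fn_map)
    from sw_cong[OF this] True show ?thesis by (simp del: repl.simps)
  next
    case False
    have "eval t \<approx> (if layer th t \<noteq> Some (th f) \<and> t \<doteq> u then Nm z else rp t)" if t: "t \<in> set ts" for t
    proof (cases "t \<doteq> u")
      case True
      have "rp t = t"
        using foreign_not_aceq[OF True] by (intro repl_id) blast
      with True False IH(1)[OF t] aceq_layer[OF True, of th] show ?thesis
        by (simp add: sw_u AC_E)
    next
      case nu: False
      with IH(1)[OF t] sw_rp[OF t] show ?thesis by (cases "layer th t = layer th u") simp_all
    qed
    then have "Fn f (map eval ts) \<approx> rp (Fn f ts)"
      unfolding repl.simps by (rule eqt_fn_map)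
    with False show ?thesis by (simp del: repl.simps)
  qed
qed (auto simp: ev_guarded)

lemma eval_id:
  assumes "nf t" "Nm z \<notin> subterms t" "\<not> t \<doteq> u" "\<forall>w\<in>foreign th t. \<not> w \<doteq> u"
  shows "eval t \<approx> t"
proof -
  have "rp t = t" using assms(4) by (rule repl_id)
  moreover have "sw (rp t) = rp t" using rp_class[OF assms(1,2)] assms(3) by (blast intro: sw_id)
  ultimately show ?thesis using eval_repl[OF assms(1,2)] by (cases "layer th t = layer th u") simp_all
qed

lemma eval_u: "eval u \<approx> Nm z"
proof -
  have "rp u = u"
    using foreign_not_aceq[OF aceq_refl] by (intro repl_id) blast
  with eval_repl[OF nf_u fresh_u] show ?thesis by (simp add: sw_u)
qed

lemma eval_Nm: "eval (Nm z') \<approx> Nm z'" if "u \<noteq> Nm z'" "z \<noteq> z'"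
proof -
  have "nf (Nm z')" using nf_Nm[OF nf_u] .
  moreover have "\<not> Nm z' \<doteq> u" using that(1) by (auto dest: aceq_Nm)
  ultimately show ?thesis using that by (intro eval_id) auto
qed

lemma eval_ectx:
  "t \<in> ectx ar th k X \<Longrightarrow> layer th u \<noteq> Some k \<Longrightarrow> eval t \<in> ectx ar th k (eval ` X)"
  by (induction rule: ectx.induct) (auto intro!: ectx.app intro: ectx.hole)

end

text \<open>Otherwise the model for M fixes all members of the context, hence t, while it sends M to
  a fresh name; so M would equal that name.\<close>

lemma foreign_root:
  assumes "M \<approx> t" "t \<in> ectx ar th k \<Gamma>" "layer th M \<noteq> Some k" "finite \<Gamma>" "nf M" "\<forall>x\<in>\<Gamma>. nf x"
  shows "\<exists>x\<in>\<Gamma>. M \<doteq> x \<or> (\<exists>w\<in>foreign th x. M \<doteq> w)"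
proof (rule ccontr)
  assume no: "\<not> ?thesis"
  obtain z where z: "Nm z \<notin> subterms M" "\<forall>x\<in>\<Gamma>. Nm z \<notin> subterms x"
    using fresh_name[of "insert M \<Gamma>"] assms(4) by auto
  let ?e = "ev th (eqt E) M (Nm z)"
  have no': "\<forall>x\<in>\<Gamma>. \<not> x \<doteq> M \<and> (\<forall>w\<in>foreign th x. \<not> w \<doteq> M)"
    using no by (metis aceq_sym)
  have id: "?e x \<approx> x" if "x \<in> \<Gamma>" for x
    using that no' z assms(5,6) by (intro eval_id) blast+
  have "?e t \<approx> t"
    using assms(2)
  proof induction
    case (app f ts)
    then have "Fn f (map ?e ts) \<approx> Fn f (map (\<lambda>t. t) ts)" by (intro eqt_fn_map) auto
    with app assms(3) show ?case by simp
  qed (rule id)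
  have "Nm z \<approx> ?e M" using eval_u[OF assms(5) z(1)] by (rule eqt_sym)
  also have "?e M \<approx> ?e t" by (rule eval_cong[OF assms(5) z(1) assms(1)])
  also note \<open>?e t \<approx> t\<close>
  also have "t \<approx> M" using assms(1) by (rule eqt_sym)
  finally have "M \<approx> Nm z" by (rule eqt_sym)
  with u_not_Nm[OF assms(5) z(1)] show False by contradiction
qed

text \<open>If T had a k-foreign subterm u, evaluating the equation in the model for u would show that T is
  equal to the term obtained by replacing u by a fresh name y. That term is reducible, and
  substituting u for y makes T reducible as well.\<close>

lemma Nm_ectx:
  assumes "T \<approx> t" "t \<in> ectx ar th k {Nm z}" "Nm z \<notin> subterms T" "nf T" "wf_trm ar th n T"
  shows "T \<in> ectx ar th k {}"
proof -
  have "layer th T = Some k"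
  proof (rule ccontr)
    assume "layer th T \<noteq> Some k"
    from foreign_root[OF assms(1,2) this _ assms(4)] nf_Nm[OF assms(4)] have "T \<doteq> Nm z" by simp
    then have "T = Nm z" using aceq_Nm aceq_sym by blast
    with assms(3) show False by simp
  qed
  moreover have "layer th u = Some k" if u: "u \<in> foreign th T" for u
  proof (rule ccontr)
    assume k: "layer th u \<noteq> Some k"
    have su: "subterms u \<subseteq> subterms T" using foreign_subterm[OF u] subterms_trans by blast
    have nf_u: "nf u" using foreign_nf[OF u assms(4)] .
    \<comment> \<open>y also differs from z, so that the model fixes the hole content
      \<open>Nm z\<close> and with it t.\<close>
    obtain y where y: "Nm y \<notin> subterms T" "y \<noteq> z"
      using fresh_name[of "{T, Nm z}"] by auto
    have fresh: "Nm y \<notin> subterms u" using su y by auto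
    let ?e = "ev th (eqt E) u (Nm y)" and ?r = "repl th (aceq ac) u (Nm y)"
    have et: "?e t \<approx> t" 
      using assms(2)
    proof induction
      case (hole M)
      have "u \<noteq> Nm z" using su assms(3) subterms_refl[of u] by blast
      with hole show ?case using eval_Nm[OF nf_u fresh, of z] y(2) by simp
    next
      case (app f ts)
      then have "Fn f (map ?e ts) \<approx> Fn f (map (\<lambda>t. t) ts)" by (intro eqt_fn_map) auto
      with app k show ?case by simp
    qed
    have "?r T \<approx> ?e T" 
      using eval_repl[OF nf_u fresh assms(4) y(1)] k \<open>layer th T = Some k\<close> by (simp add: eqt_sym)
    also have "?e T \<approx> ?e t" by (rule eval_cong[OF nf_u fresh assms(1)])
    also note et
    also have "t \<approx> T" using assms(1) by (rule eqt_sym)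
    finally have "?r T \<approx> T" .
    from join[OF this assms(4)] obtain s where s: "(?r T, s) \<in> (rmod ac RE)\<^sup>*" "s \<doteq> T"
      by blast
    \<comment> \<open>AC equality preserves guarded subterms, and y occurs on the left side
      only.\<close>
    have "\<not> ?r T \<doteq> T"
    proof
      assume "?r T \<doteq> T"
      moreover have "Nm y \<in> subterms (?r T)" using Nm_in_repl[OF u] by simp
      ultimately obtain a where "a \<in> subterms T" "Nm y \<doteq> a"
        using aceq_guarded_subterm[of "?r T" T ac "Nm y"] by auto
      with y(1) show False using aceq_Nm by blast
    qed
    with s obtain s' where "(?r T, s') \<in> rmod ac RE" by (metis converse_rtranclE)
    then have "(sub y u (?r T), sub y u s') \<in> rmod ac RE" by (rule sub_rmod)
    then have "\<not> nf (sub y u (?r T))" by (auto simp: nf_mod_def)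
    moreover have "nf (sub y u (?r T))"
      using aceq_nf[OF aceq_sym[OF sub_repl[OF y(1)]] assms(4)] .
    ultimately show False by blast
  qed
  ultimately have "{w \<in> foreign th T. layer th w \<noteq> Some k} = {}" "layer th T = Some k"
    by blast+
  with ectx_foreign[OF assms(5), of k] show ?thesis by simp
qed

text \<open>The exclusions in \<open>no\<close> are what \<open>eval_id\<close> needs to fix T and
  the context; \<open>cut_id\<close> treats the excluded cases by other means.\<close>

lemma discard_foreign:
  assumes "T \<approx> t" "t \<in> ectx ar th k (insert M \<Gamma>)" "layer th M \<noteq> Some k"
    and "finite \<Gamma>" "nf M" "\<forall>x\<in>insert T \<Gamma>. nf x" "wf_trm ar th n T"
    and no: "\<forall>x\<in>insert T \<Gamma>. \<not> M \<doteq> x \<and> (\<forall>w\<in>foreign th x. \<not> M \<doteq> w)"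
  shows "\<exists>t'\<in>ectx ar th k \<Gamma>. T \<approx> t'"
proof -
  obtain z where z: "Nm z \<notin> subterms M" "\<forall>x\<in>insert T \<Gamma>. Nm z \<notin> subterms x"
    using fresh_name[of "insert M (insert T \<Gamma>)"] assms(4) by auto
  let ?e = "ev th (eqt E) M (Nm z)"
  have no': "\<forall>x\<in>insert T \<Gamma>. \<not> x \<doteq> M \<and> (\<forall>w\<in>foreign th x. \<not> w \<doteq> M)"
    using no by (metis aceq_sym)
  have id: "?e x \<approx> x" if "x \<in> insert T \<Gamma>" for x
    using that no' z assms(5,6) by (intro eval_id) blast+
  have "?e t \<in> ectx ar th k (?e ` insert M \<Gamma>)"
    using eval_ectx[OF assms(5) z(1) assms(2,3)] .
  moreover have "\<exists>y\<in>ectx ar th k (insert (Nm z) \<Gamma>). x \<approx> y" if "x \<in> ?e ` insert M \<Gamma>" for x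
    using that id eval_u[OF assms(5) z(1)] by (blast intro: ectx.hole)
  ultimately obtain t' where t': "t' \<in> ectx ar th k (insert (Nm z) \<Gamma>)" "?e t \<approx> t'"
    using ectx_eqt[of "?e t" ar th k "?e ` insert M \<Gamma>"] by blast
  have "T \<approx> ?e T" by (rule eqt_sym[OF id]) simp
  also have "?e T \<approx> ?e t" by (rule eval_cong[OF assms(5) z(1) assms(1)])
  also note t'(2)
  finally have T: "T \<approx> t'" .
  show ?thesis
  \<comment> \<open>With an empty context there is nothing to put for z, but then T itself is a
    context without holes.\<close>
  proof (cases "\<Gamma> = {}")
    case True
    then have "T \<in> ectx ar th k \<Gamma>"
      using Nm_ectx[OF T] t' z assms by auto
    then show ?thesis using eqt_refl by blast
  next
    case False
    then obtain x where x: "x \<in> \<Gamma>" by blast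
    have "sub z x t' \<in> ectx ar th k (sub z x ` insert (Nm z) \<Gamma>)" using t'(1) by (rule ectx_sub)
    moreover have "sub z x ` insert (Nm z) \<Gamma> = \<Gamma>" using z x by (force simp: sub_fresh)
    moreover have "T \<approx> sub z x t'" using sub_eqt[OF T, of z x] z by (simp add: sub_fresh)
    ultimately show ?thesis by auto
  qed
qed

end

section \<open>Cut-free derivations\<close>

lemma D_seqok: "D ar th ac n Es RE c \<Gamma> M \<Longrightarrow> seqok ar th ac n RE \<Gamma> M"
  by (induction rule: D.induct) auto

text \<open>Every derivation has an id leaf. Having at least one theory gives the axiom for members,
  by the trivial context.\<close>

lemma D_theory: "D ar th ac n Es RE c \<Gamma> M \<Longrightarrow> 0 < n"
  by (induction rule: D.induct) auto

context combination
begin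

abbreviation term_ok where "term_ok t \<equiv> wf_trm ar th n t \<and> nf t"
abbreviation ctx_ok where "ctx_ok \<Gamma> \<equiv> finite \<Gamma> \<and> (\<forall>t\<in>\<Gamma>. term_ok t)"
abbreviation Dcf (infix "\<tturnstile>" 50) where "\<Gamma> \<tturnstile> M \<equiv> D ar th ac n Es RE False \<Gamma> M"

lemma seqok_iff: "seqok ar th ac n RE \<Gamma> M \<longleftrightarrow> ctx_ok \<Gamma> \<and> term_ok M"
  by (auto simp: seqok_def)

lemma D_ok: "D ar th ac n Es RE c \<Gamma> M \<Longrightarrow> ctx_ok \<Gamma> \<and> term_ok M"
  using D_seqok seqok_iff by blast

lemma term_ok_aceq: "s \<doteq> t \<Longrightarrow> term_ok s \<Longrightarrow> term_ok t"
  using aceq_wf[of s t ac ar th n] aceq_nf[of s t ac RE] by simp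

lemma idE_cf:
  "ctx_ok \<Gamma> \<Longrightarrow> term_ok M \<Longrightarrow> i < n \<Longrightarrow> t \<in> ectx ar th i \<Gamma> \<Longrightarrow> M \<approx> t \<Longrightarrow> \<Gamma> \<tturnstile> M"
  by (rule D.idE) (auto simp: seqok_iff conv_eqt)

lemma D_member: "0 < n \<Longrightarrow> ctx_ok \<Gamma> \<Longrightarrow> M \<in> \<Gamma> \<Longrightarrow> \<Gamma> \<tturnstile> M"
  by (rule idE_cf[of _ _ 0 M]) (auto intro: ectx.hole)

text \<open>Contexts are sets, so the principal term may already lie in \<Gamma>; this and the next
  four lemmas state the left rules in that form.\<close>

lemma pL_member:
  assumes "Pair A B \<in> \<Gamma>" "insert A (insert B \<Gamma>) \<tturnstile> T" shows "\<Gamma> \<tturnstile> T"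
proof -
  have "insert (Pair A B) \<Gamma> = \<Gamma>" "{Pair A B, A, B} \<union> \<Gamma> = insert A (insert B \<Gamma>)"
    using assms(1) by auto
  with D.pL[of ar th ac n RE A B \<Gamma> T Es False] assms(2) D_ok[OF assms(2)] show ?thesis
    by (simp add: seqok_iff)
qed

lemma eL_member:
  assumes "Enc A K \<in> \<Gamma>" "\<Gamma> \<tturnstile> K" "insert A (insert K \<Gamma>) \<tturnstile> T" shows "\<Gamma> \<tturnstile> T"
proof -
  have "insert (Enc A K) \<Gamma> = \<Gamma>" "{Enc A K, A, K} \<union> \<Gamma> = insert A (insert K \<Gamma>)"
    using assms(1) by auto
  with D.eL[of ar th ac n RE A K \<Gamma> T Es False] assms D_ok[OF assms(3)] show ?thesis
    by (simp add: seqok_iff)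
qed

lemma blindL1_member:
  assumes "Blind A K \<in> \<Gamma>" "\<Gamma> \<tturnstile> K" "insert A (insert K \<Gamma>) \<tturnstile> T" shows "\<Gamma> \<tturnstile> T"
proof -
  have "insert (Blind A K) \<Gamma> = \<Gamma>" "{Blind A K, A, K} \<union> \<Gamma> = insert A (insert K \<Gamma>)"
    using assms(1) by auto
  with D.blindL1[of ar th ac n RE A K \<Gamma> T Es False] assms D_ok[OF assms(3)] show ?thesis
    by (simp add: seqok_iff)
qed

lemma signL_member:
  assumes "Sign A K \<in> \<Gamma>" "Pub L \<in> \<Gamma>" "K \<doteq> L" "insert A \<Gamma> \<tturnstile> T" shows "\<Gamma> \<tturnstile> T"
proof -
  have "{Sign A K, Pub L} \<union> \<Gamma> = \<Gamma>" "{Sign A K, Pub L, A} \<union> \<Gamma> = insert A \<Gamma>"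
    using assms(1,2) by auto
  moreover have "term_ok (Sign A K)" "term_ok (Pub L)"
    using assms(1,2) D_ok[OF assms(4)] by auto
  ultimately show ?thesis
    using D.signL[of ar th ac n RE A K L \<Gamma> T Es False] assms D_ok[OF assms(4)]
    by (simp add: seqok_iff)
qed

lemma blindL2_member:
  assumes "Sign (Blind A R) K \<in> \<Gamma>" "\<Gamma> \<tturnstile> R" "insert (Sign A K) (insert R \<Gamma>) \<tturnstile> T"
  shows "\<Gamma> \<tturnstile> T"
proof -
  have "insert (Sign (Blind A R) K) \<Gamma> = \<Gamma>"
    "{Sign (Blind A R) K, Sign A K, R} \<union> \<Gamma> = insert (Sign A K) (insert R \<Gamma>)"
    using assms(1) by auto
  with D.blindL2[of ar th ac n RE A R K \<Gamma> T Es False] assms D_ok[OF assms(3)] show ?thesis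
    by (simp add: seqok_iff)
qed

lemma gs_member:
  assumes "t \<in> insert M \<Gamma>" "A \<in> subterms t" "guarded A" "\<Gamma> \<tturnstile> A" "insert A \<Gamma> \<tturnstile> M"
  shows "\<Gamma> \<tturnstile> M"
proof (rule D.gs[OF _ assms(3) _ assms(4,5)])
  show "seqok ar th ac n RE \<Gamma> M" using D_ok[OF assms(5)] by (simp add: seqok_iff)
qed (use assms(1,2) in blast)

lemma cs_member:
  assumes "t \<in> insert M \<Gamma>" "N \<in> cross_sub th t" "\<Gamma> \<tturnstile> N" "insert N \<Gamma> \<tturnstile> M"
  shows "\<Gamma> \<tturnstile> M"
proof (rule D.cs[OF _ _ assms(3,4)])
  show "seqok ar th ac n RE \<Gamma> M" using D_ok[OF assms(4)] by (simp add: seqok_iff)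
qed (use assms(1,2) in blast)

text \<open>gs handles the guarded foreign subterms and cs the unguarded ones, so together they
  allow a cut on any of them.\<close>

lemma foreign_cut:
  assumes "t \<in> insert M \<Gamma>" "w \<in> foreign th t" "\<Gamma> \<tturnstile> w" "insert w \<Gamma> \<tturnstile> M"
  shows "\<Gamma> \<tturnstile> M"
proof (cases "guarded w")
  case True
  with gs_member[OF assms(1) _ True assms(3,4)] foreign_subterm[OF assms(2)] show ?thesis by blast
next
  case False
  with cs_member[OF assms(1) _ assms(3,4)] foreign_cross_sub[OF assms(2)] show ?thesis by blast
qed

section \<open>Invariance of cut-free derivability under AC and weakening\<close>

text \<open>Several AC-equal members of \<Gamma> may collapse to one member of \<Delta>, so
  contraction modulo AC is included.\<close>

definition covers :: "'f trm set \<Rightarrow> 'f trm set \<Rightarrow> bool" where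
  "covers \<Gamma> \<Delta> \<longleftrightarrow> (\<forall>t\<in>\<Gamma>. \<exists>t'\<in>\<Delta>. t \<doteq> t')"

lemma covers_insert: "covers \<Gamma> \<Delta> \<Longrightarrow> a \<doteq> b \<Longrightarrow> covers (insert a \<Gamma>) (insert b \<Delta>)"
  by (auto simp: covers_def)

lemma covers_member: "covers \<Gamma> \<Delta> \<Longrightarrow> t \<in> \<Gamma> \<Longrightarrow> \<exists>t'\<in>\<Delta>. t \<doteq> t'"
  by (auto simp: covers_def)

lemma covers_subset: "\<Gamma> \<subseteq> \<Delta> \<Longrightarrow> covers \<Gamma> \<Delta>"
  unfolding covers_def using bex_aceq by blast

lemma covers_mono: "covers \<Gamma> \<Delta> \<Longrightarrow> \<Gamma>' \<subseteq> \<Gamma> \<Longrightarrow> covers \<Gamma>' \<Delta>"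
  unfolding covers_def by blast

text \<open>id sees terms modulo E, but the other rules and the side conditions see them literally.
  Passing to AC-equal terms therefore takes an induction, and weakening comes with it.\<close>

lemma D_aceq:
  "\<Gamma> \<tturnstile> M \<Longrightarrow> M \<doteq> M' \<Longrightarrow> covers \<Gamma> \<Delta> \<Longrightarrow> ctx_ok \<Delta> \<Longrightarrow> \<Delta> \<tturnstile> M'"
proof (induction arbitrary: \<Delta> M' rule: D.induct)
  case (idE \<Gamma> M i t)
  obtain t' where t': "t' \<in> ectx ar th i \<Delta>" "t \<doteq> t'"
    using ectx_eqt[OF idE(3), of \<Delta> "ac_rules ac"] covers_member[OF idE(6)]
    unfolding aceq_eqt by (meson ectx.hole)
  have "M' \<approx> M" using AC_E[OF aceq_sym[OF idE(5)]] .
  also have "M \<approx> t" using idE(4) by (simp add: conv_eqt)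
  also have "t \<approx> t'" using AC_E[OF t'(2)] .
  finally show ?case
    using idE term_ok_aceq[OF idE(5)] t' by (intro idE_cf) (auto simp: seqok_iff)
next
  case (cut \<Gamma> T M)
  then show ?case by simp
next
  case (pL A B \<Gamma> T)
  obtain a b where ab: "Pair a b \<in> \<Delta>" "A \<doteq> a" "B \<doteq> b"
    using covers_member[OF pL(5), of "Pair A B"] aceq_Pair by blast
  have "term_ok A" "term_ok B" using D_ok[OF pL(2)] by auto
  with ab term_ok_aceq pL(6) have "ctx_ok (insert a (insert b \<Delta>))" by blast
  moreover have "covers ({Pair A B, A, B} \<union> \<Gamma>) (insert a (insert b \<Delta>))"
    using covers_insert[OF covers_insert[OF pL(5) ab(3)] ab(2)] by (rule covers_mono) auto
  ultimately show ?case using pL_member[OF ab(1)] pL(3,4) by blast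
next
  case (pR \<Gamma> A B)
  obtain a b where ab: "M' = Pair a b" "A \<doteq> a" "B \<doteq> b" using aceq_Pair[OF pR(6)] by blast
  have "seqok ar th ac n RE \<Delta> M'"
    using pR(1,8) term_ok_aceq[OF pR(6)] by (simp add: seqok_iff)
  then show ?case
    unfolding ab(1) using pR(4)[OF ab(2) pR(7,8)] pR(5)[OF ab(3) pR(7,8)] by (rule D.pR)
next
  case (eL A K \<Gamma> T)
  obtain a b where ab: "Enc a b \<in> \<Delta>" "A \<doteq> a" "K \<doteq> b"
    using covers_member[OF eL(7), of "Enc A K"] aceq_Enc by blast
  have "term_ok A" "term_ok K" using D_ok[OF eL(3)] by auto
  with ab term_ok_aceq eL(8) have "ctx_ok (insert a (insert b \<Delta>))" by blast
  moreover have "covers ({Enc A K, A, K} \<union> \<Gamma>) (insert a (insert b \<Delta>))"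
    using covers_insert[OF covers_insert[OF eL(7) ab(3)] ab(2)] by (rule covers_mono) auto
  moreover have "\<Delta> \<tturnstile> b" using eL(4)[OF ab(3) eL(7,8)] .
  ultimately show ?case using eL_member[OF ab(1)] eL(5,6) by blast
next
  case (eR \<Gamma> A B)
  obtain a b where ab: "M' = Enc a b" "A \<doteq> a" "B \<doteq> b" using aceq_Enc[OF eR(6)] by blast
  have "seqok ar th ac n RE \<Delta> M'"
    using eR(1,8) term_ok_aceq[OF eR(6)] by (simp add: seqok_iff)
  then show ?case
    unfolding ab(1) using eR(4)[OF ab(2) eR(7,8)] eR(5)[OF ab(3) eR(7,8)] by (rule D.eR)
next
  case (signL A K L \<Gamma> T)
  obtain a k where ab: "Sign a k \<in> \<Delta>" "A \<doteq> a" "K \<doteq> k"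
    using covers_member[OF signL(6), of "Sign A K"] aceq_Sign by blast
  obtain l where l: "Pub l \<in> \<Delta>" "L \<doteq> l"
    using covers_member[OF signL(6), of "Pub L"] aceq_Pub by blast
  have "k \<doteq> l" using ab(3) signL(2) l(2) by (metis aceq_trans aceq_sym)
  have "term_ok A" using D_ok[OF signL(3)] by auto
  with ab term_ok_aceq signL(7) have "ctx_ok (insert a \<Delta>)" by blast
  moreover have "covers ({Sign A K, Pub L, A} \<union> \<Gamma>) (insert a \<Delta>)"
    using covers_insert[OF signL(6) ab(2)] by (rule covers_mono) auto
  ultimately show ?case using signL_member[OF ab(1) l(1) \<open>k \<doteq> l\<close>] signL(4,5) by blast
next
  case (signR \<Gamma> A B)
  obtain a b where ab: "M' = Sign a b" "A \<doteq> a" "B \<doteq> b" using aceq_Sign[OF signR(6)] by blast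
  have "seqok ar th ac n RE \<Delta> M'"
    using signR(1,8) term_ok_aceq[OF signR(6)] by (simp add: seqok_iff)
  then show ?case
    unfolding ab(1) using signR(4)[OF ab(2) signR(7,8)] signR(5)[OF ab(3) signR(7,8)] by (rule D.signR)
next
  case (blindL1 A K \<Gamma> T)
  obtain a b where ab: "Blind a b \<in> \<Delta>" "A \<doteq> a" "K \<doteq> b"
    using covers_member[OF blindL1(7), of "Blind A K"] aceq_Blind by blast
  have "term_ok A" "term_ok K" using D_ok[OF blindL1(3)] by auto
  with ab term_ok_aceq blindL1(8) have "ctx_ok (insert a (insert b \<Delta>))" by blast
  moreover have "covers ({Blind A K, A, K} \<union> \<Gamma>) (insert a (insert b \<Delta>))"
    using covers_insert[OF covers_insert[OF blindL1(7) ab(3)] ab(2)] by (rule covers_mono) auto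
  moreover have "\<Delta> \<tturnstile> b" using blindL1(4)[OF ab(3) blindL1(7,8)] .
  ultimately show ?case using blindL1_member[OF ab(1)] blindL1(5,6) by blast
next
  case (blindR \<Gamma> A B)
  obtain a b where ab: "M' = Blind a b" "A \<doteq> a" "B \<doteq> b" using aceq_Blind[OF blindR(6)] by blast
  have "seqok ar th ac n RE \<Delta> M'"
    using blindR(1,8) term_ok_aceq[OF blindR(6)] by (simp add: seqok_iff)
  then show ?case
    unfolding ab(1) using blindR(4)[OF ab(2) blindR(7,8)] blindR(5)[OF ab(3) blindR(7,8)] by (rule D.blindR)
next
  case (blindL2 A R K \<Gamma> T)
  obtain b k where b: "Sign b k \<in> \<Delta>" "Blind A R \<doteq> b" "K \<doteq> k"
    using covers_member[OF blindL2(7), of "Sign (Blind A R) K"] aceq_Sign by blast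
  then obtain a r where ab: "Sign (Blind a r) k \<in> \<Delta>" "A \<doteq> a" "R \<doteq> r" "K \<doteq> k"
    using aceq_Blind[OF b(2)] by blast
  have "Sign A K \<doteq> Sign a K"
    using ab(2) unfolding aceq_eqt by (rule eqt_ctxt[where F = "\<lambda>t. Sign t K"]) (rule ctxt_cl.sign1)
  also have "Sign a K \<doteq> Sign a k"
    using ab(4) unfolding aceq_eqt by (rule eqt_ctxt[where F = "Sign a"]) (rule ctxt_cl.sign2)
  finally have sg: "Sign A K \<doteq> Sign a k" .
  have "term_ok (Sign A K)" "term_ok R" using D_ok[OF blindL2(3)] by auto
  with ab sg term_ok_aceq blindL2(8) have "ctx_ok (insert (Sign a k) (insert r \<Delta>))" by blast
  moreover have "covers ({Sign (Blind A R) K, Sign A K, R} \<union> \<Gamma>) (insert (Sign a k) (insert r \<Delta>))"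
    using covers_insert[OF covers_insert[OF blindL2(7) ab(3)] sg] by (rule covers_mono) auto
  moreover have "\<Delta> \<tturnstile> r" using blindL2(4)[OF ab(3) blindL2(7,8)] .
  ultimately show ?case using blindL2_member[OF ab(1)] blindL2(5,6) by blast
next
  case (gs \<Gamma> M A)
  obtain t where t: "t \<in> insert M \<Gamma>" "A \<in> subterms t" using gs(3) by blast
  obtain t' where t': "t' \<in> insert M' \<Delta>" "t \<doteq> t'"
    using covers_member[OF covers_insert[OF gs(9,8)] t(1)] by blast
  obtain a where a: "a \<in> subterms t'" "guarded a" "A \<doteq> a"
    using aceq_guarded_subterm[OF t'(2) t(2) gs(2)] by blast
  have "term_ok A" using D_ok[OF gs(4)] by simp
  with gs(10) term_ok_aceq[OF a(3)] have "ctx_ok (insert a \<Delta>)" by blast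
  then have "insert a \<Delta> \<tturnstile> M'" using gs(7)[OF gs(8) covers_insert[OF gs(9) a(3)]] by blast
  moreover have "\<Delta> \<tturnstile> a" using gs(6)[OF a(3) gs(9,10)] .
  ultimately show ?case using gs_member[OF t'(1) a(1,2)] by blast
next
  case (cs \<Gamma> M A)
  obtain t where t: "t \<in> insert M \<Gamma>" "A \<in> cross_sub th t" using cs(2) by blast
  obtain t' where t': "t' \<in> insert M' \<Delta>" "t \<doteq> t'"
    using covers_member[OF covers_insert[OF cs(8,7)] t(1)] by blast
  obtain a where a: "a \<in> cross_sub th t'" "A \<doteq> a"
    using aceq_cross_sub[OF t'(2) t(2)] by blast
  have "term_ok A" using D_ok[OF cs(3)] by simp
  with cs(9) term_ok_aceq[OF a(2)] have "ctx_ok (insert a \<Delta>)" by blast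
  then have "insert a \<Delta> \<tturnstile> M'" using cs(6)[OF cs(7) covers_insert[OF cs(8) a(2)]] by blast
  moreover have "\<Delta> \<tturnstile> a" using cs(5)[OF a(2) cs(8,9)] .
  ultimately show ?case using cs_member[OF t'(1) a(1)] by blast
qed

lemma D_weaken: "\<Gamma> \<tturnstile> M \<Longrightarrow> \<Gamma> \<subseteq> \<Delta> \<Longrightarrow> ctx_ok \<Delta> \<Longrightarrow> \<Delta> \<tturnstile> M"
  using D_aceq covers_subset aceq_refl by blast

section \<open>Cut elimination\<close>

text \<open>The case of a right premise ending in id for theory k. By \<open>same\<close>, an M
  headed in theory k is itself a k-context over \<Gamma>, and the two contexts compose.\<close>

lemma cut_id:
  assumes "\<Gamma> \<tturnstile> M" and "T \<approx> t" "t \<in> ectx ar th k (insert M \<Gamma>)" "k < n" "term_ok T"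
    and same: "layer th M = Some k \<Longrightarrow> \<exists>s\<in>ectx ar th k \<Gamma>. M \<approx> s"
  shows "\<Gamma> \<tturnstile> T"
proof -
  have ok: "ctx_ok \<Gamma>" "term_ok M" using D_ok[OF assms(1)] by auto
  have drop: "\<Gamma> \<tturnstile> T" if M: "\<exists>s\<in>ectx ar th k \<Gamma>. M \<approx> s"
  proof -
    have "\<exists>s\<in>ectx ar th k \<Gamma>. x \<approx> s" if "x \<in> insert M \<Gamma>" for x
      using that M eqt_refl by (blast intro: ectx.hole)
    then obtain t' where t': "t' \<in> ectx ar th k \<Gamma>" "t \<approx> t'"
      using ectx_eqt[OF assms(3)] by blast
    from idE_cf[OF ok(1) assms(5,4) t'(1) eqt_trans[OF assms(2) t'(2)]] show ?thesis .
  qed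
  consider "layer th M = Some k" | "M \<doteq> T" | x where "x \<in> \<Gamma>" "M \<doteq> x"
    | x w where "x \<in> insert T \<Gamma>" "w \<in> foreign th x" "M \<doteq> w"
    | "layer th M \<noteq> Some k" "\<forall>x\<in>insert T \<Gamma>. \<not> M \<doteq> x \<and> (\<forall>w\<in>foreign th x. \<not> M \<doteq> w)"
    by blast
  then show ?thesis
  proof cases
    case 1
    then show ?thesis using drop same by blast
  next
    case 2
    then show ?thesis using D_aceq[OF assms(1)] covers_subset ok by blast
  next
    case 3
    then show ?thesis using drop AC_E by (blast intro: ectx.hole)
  next
    case 4
    \<comment> \<open>The cut moves from M to its AC copy w, which literally occurs in the
      conclusion as gs and cs require.\<close>
    have w: "\<Gamma> \<tturnstile> w" using D_aceq[OF assms(1) 4(3)] covers_subset ok by blast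
    have "\<exists>s\<in>ectx ar th k (insert w \<Gamma>). x \<approx> s" if "x \<in> insert M \<Gamma>" for x
      using that AC_E[OF 4(3)] eqt_refl by (blast intro: ectx.hole)
    then obtain t' where t': "t' \<in> ectx ar th k (insert w \<Gamma>)" "t \<approx> t'"
      using ectx_eqt[OF assms(3)] by blast
    have "ctx_ok (insert w \<Gamma>)" using ok(1) D_ok[OF w] by blast
    from idE_cf[OF this assms(5,4) t'(1) eqt_trans[OF assms(2) t'(2)]]
    show ?thesis by (rule foreign_cut[OF 4(1,2) w])
  next
    case 5
    have "finite \<Gamma>" "nf M" "\<forall>x\<in>insert T \<Gamma>. nf x" "wf_trm ar th n T" using ok assms(5) by auto
    from discard_foreign[OF assms(2,3) 5(1) this 5(2)] obtain t' where
      "t' \<in> ectx ar th k \<Gamma>" "T \<approx> t'" by blast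
    then show ?thesis using idE_cf[OF ok(1) assms(5,4)] by blast
  qed
qed

text \<open>The case of a left premise ending in id for a theory other than that of the head of M.
  By \<open>foreign_root\<close>, M is present in \<Gamma> up to AC, as a member or as a foreign
  subterm of one.\<close>

lemma cut_foreign:
  assumes "\<Gamma> \<tturnstile> M" "insert M \<Gamma> \<tturnstile> T" "M \<approx> s" "s \<in> ectx ar th k \<Gamma>" "layer th M \<noteq> Some k"
  shows "\<Gamma> \<tturnstile> T"
proof -
  have ok: "ctx_ok \<Gamma>" "term_ok M" using D_ok[OF assms(1)] by auto
  have "finite \<Gamma>" "nf M" "\<forall>x\<in>\<Gamma>. nf x" using ok by auto
  from foreign_root[OF assms(3-5) this] obtain x where x: "x \<in> \<Gamma>"
    "M \<doteq> x \<or> (\<exists>w\<in>foreign th x. M \<doteq> w)" by blast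
  from x(2) show ?thesis
  proof (elim disjE bexE)
    assume "M \<doteq> x"
    then have "covers (insert M \<Gamma>) \<Gamma>" using x(1) by (auto simp: covers_def intro: bex_aceq)
    then show ?thesis using D_aceq[OF assms(2) aceq_refl] ok by blast
  next
    fix w assume w: "w \<in> foreign th x" "M \<doteq> w"
    have "\<Gamma> \<tturnstile> w" using D_aceq[OF assms(1) w(2)] covers_subset ok by blast
    moreover have "ctx_ok (insert w \<Gamma>)" using ok term_ok_aceq[OF w(2)] by blast
    then have "insert w \<Gamma> \<tturnstile> T"
      using D_aceq[OF assms(2) aceq_refl covers_insert[OF covers_subset w(2)]] by blast
    ultimately show ?thesis using foreign_cut[of x T \<Gamma> w] x(1) w(1) by blast
  qed
qed

text \<open>The left derivation enters only through what its last rule provides: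
  \<open>parts\<close> for a right rule, \<open>same\<close> for id in the head theory of M. No
  right rule builds \<open>Pub\<close>. The context \<Gamma> grows along the right derivation, while
  \<open>\<Gamma>\<^sub>0\<close>, from which M was derived, stays fixed.\<close>

lemma cut_principal:
  assumes IH: "\<And>A \<Gamma> T. size A < size M \<Longrightarrow> \<Gamma> \<tturnstile> A \<Longrightarrow> insert A \<Gamma> \<tturnstile> T \<Longrightarrow> \<Gamma> \<tturnstile> T"
    and M: "\<Gamma>\<^sub>0 \<tturnstile> M"
    and same: "\<And>k. layer th M = Some k \<Longrightarrow> \<exists>s\<in>ectx ar th k \<Gamma>\<^sub>0. M \<approx> s"
    and parts: "\<And>A B. M \<in> {Pair A B, Enc A B, Sign A B, Blind A B} \<Longrightarrow> \<Gamma>\<^sub>0 \<tturnstile> A \<and> \<Gamma>\<^sub>0 \<tturnstile> B"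
    and not_Pub: "\<And>L. M \<noteq> Pub L"
  shows "\<Delta> \<tturnstile> T \<Longrightarrow> \<Delta> \<subseteq> insert M \<Gamma> \<Longrightarrow> \<Gamma>\<^sub>0 \<subseteq> \<Gamma> \<Longrightarrow> ctx_ok \<Gamma> \<Longrightarrow> \<Gamma> \<tturnstile> T"
proof (induction arbitrary: \<Gamma> rule: D.induct)
  case (idE \<Delta> T i t)
  have "\<Gamma> \<tturnstile> M" using D_weaken[OF M idE(6,7)] .
  then show ?case
  proof (rule cut_id)
    show "T \<approx> t" using idE(4) by (simp add: conv_eqt)
    show "t \<in> ectx ar th i (insert M \<Gamma>)" using ectx_mono[OF idE(3,5)] .
    show "i < n" "term_ok T" using idE by (auto simp: seqok_iff)
    show "\<exists>s\<in>ectx ar th i \<Gamma>. M \<approx> s" if "layer th M = Some i"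
      using same[OF that] ectx_mono[OF _ idE(6)] by blast
  qed
next
  case (cut \<Gamma> T M)
  then show ?case by simp
next
  case (pL A B \<Delta> T)
  have "ctx_ok (insert A (insert B \<Gamma>))" using D_ok[OF pL(2)] pL(6) by simp
  then have T: "insert A (insert B \<Gamma>) \<tturnstile> T" using pL(3)[of "insert A (insert B \<Gamma>)"] pL(4,5) by blast
  show ?case
  proof (cases "Pair A B = M")
    case True
    have AB: "\<Gamma> \<tturnstile> A" "\<Gamma> \<tturnstile> B" using parts[of A B] True D_weaken[OF _ pL(5,6)] by auto
    have "insert B \<Gamma> \<tturnstile> A" using D_weaken[OF AB(1)] D_ok[OF AB(2)] by blast
    from IH[OF _ this T] have "insert B \<Gamma> \<tturnstile> T" using True by auto
    from IH[OF _ AB(2) this] show ?thesis using True by auto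
  next
    case False
    then show ?thesis using pL_member[OF _ T] pL(4) by blast
  qed
next
  case (pR \<Delta> A B)
  then have "seqok ar th ac n RE \<Gamma> (Pair A B)" by (simp add: seqok_iff)
  then show ?case using pR(4)[OF pR(6-8)] pR(5)[OF pR(6-8)] by (rule D.pR)
next
  case (eL A K \<Delta> T)
  have "ctx_ok (insert A (insert K \<Gamma>))" using D_ok[OF eL(3)] eL(8) by simp
  then have T: "insert A (insert K \<Gamma>) \<tturnstile> T" using eL(5)[of "insert A (insert K \<Gamma>)"] eL(6,7) by blast
  have K: "\<Gamma> \<tturnstile> K" using eL(4)[OF eL(6-8)] .
  show ?case
  proof (cases "Enc A K = M")
    case True
    have A: "\<Gamma> \<tturnstile> A" using parts[of A K] True D_weaken[OF _ eL(7,8)] by auto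
    have "insert K \<Gamma> \<tturnstile> A" using D_weaken[OF A] D_ok[OF K] by blast
    from IH[OF _ this T] have "insert K \<Gamma> \<tturnstile> T" using True by auto
    from IH[OF _ K this] show ?thesis using True by auto
  next
    case False
    then show ?thesis using eL_member[OF _ K T] eL(6) by blast
  qed
next
  case (eR \<Delta> A B)
  then have "seqok ar th ac n RE \<Gamma> (Enc A B)" by (simp add: seqok_iff)
  then show ?case using eR(4)[OF eR(6-8)] eR(5)[OF eR(6-8)] by (rule D.eR)
next
  case (signL A K L \<Delta> T)
  have "ctx_ok (insert A \<Gamma>)" using D_ok[OF signL(3)] signL(7) by simp
  then have T: "insert A \<Gamma> \<tturnstile> T" using signL(4)[of "insert A \<Gamma>"] signL(5,6) by blast
  \<comment> \<open>As M is no public key, the key that opens the signature survives the removal of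
    M.\<close>
  have L: "Pub L \<in> \<Gamma>" using signL(5) not_Pub by blast
  show ?case
  proof (cases "Sign A K = M")
    case True
    have A: "\<Gamma> \<tturnstile> A" using parts[of A K] True D_weaken[OF _ signL(6,7)] by auto
    from IH[OF _ A T] show ?thesis using True by auto
  next
    case False
    then show ?thesis using signL_member[OF _ L signL(2) T] signL(5) by blast
  qed
next
  case (signR \<Delta> A B)
  then have "seqok ar th ac n RE \<Gamma> (Sign A B)" by (simp add: seqok_iff)
  then show ?case using signR(4)[OF signR(6-8)] signR(5)[OF signR(6-8)] by (rule D.signR)
next
  case (blindL1 A K \<Delta> T)
  have "ctx_ok (insert A (insert K \<Gamma>))" using D_ok[OF blindL1(3)] blindL1(8) by simp
  then have T: "insert A (insert K \<Gamma>) \<tturnstile> T"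
    using blindL1(5)[of "insert A (insert K \<Gamma>)"] blindL1(6,7) by blast
  have K: "\<Gamma> \<tturnstile> K" using blindL1(4)[OF blindL1(6-8)] .
  show ?case
  proof (cases "Blind A K = M")
    case True
    have A: "\<Gamma> \<tturnstile> A" using parts[of A K] True D_weaken[OF _ blindL1(7,8)] by auto
    have "insert K \<Gamma> \<tturnstile> A" using D_weaken[OF A] D_ok[OF K] by blast
    from IH[OF _ this T] have "insert K \<Gamma> \<tturnstile> T" using True by auto
    from IH[OF _ K this] show ?thesis using True by auto
  next
    case False
    then show ?thesis using blindL1_member[OF _ K T] blindL1(6) by blast
  qed
next
  case (blindR \<Delta> A B)
  then have "seqok ar th ac n RE \<Gamma> (Blind A B)" by (simp add: seqok_iff)
  then show ?case using blindR(4)[OF blindR(6-8)] blindR(5)[OF blindR(6-8)] by (rule D.blindR)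
next
  case (blindL2 A R K \<Delta> T)
  have S: "term_ok (Sign A K)" using D_ok[OF blindL2(3)] by simp
  have "ctx_ok (insert (Sign A K) (insert R \<Gamma>))" using D_ok[OF blindL2(3)] blindL2(8) by simp
  then have T: "insert (Sign A K) (insert R \<Gamma>) \<tturnstile> T"
    using blindL2(5)[of "insert (Sign A K) (insert R \<Gamma>)"] blindL2(6,7) by blast
  have R: "\<Gamma> \<tturnstile> R" using blindL2(4)[OF blindL2(6-8)] .
  show ?case
  proof (cases "Sign (Blind A R) K = M")
    case True
    have B: "\<Gamma> \<tturnstile> Blind A R" and K: "\<Gamma> \<tturnstile> K"
      using parts[of "Blind A R" K] True D_weaken[OF _ blindL2(7,8)] by auto
    txt \<open>The signed message is recovered by unblinding, through a cut on the smaller Blind A R.\<close>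
    have ok: "ctx_ok (insert (Blind A R) \<Gamma>)" using D_ok[OF B] by blast
    have "nf A"
      by (rule nf_ctxt[where F = "\<lambda>t. Blind t R"]) (use D_ok[OF B] in simp, rule ctxt_cl.blind1)
    then have "term_ok A" "term_ok R" using D_ok[OF B] D_ok[OF R] by auto
    then have "insert A (insert R (insert (Blind A R) \<Gamma>)) \<tturnstile> A"
      using ok by (intro D_member[OF D_theory[OF R]]) auto
    then have "insert (Blind A R) \<Gamma> \<tturnstile> A"
      using blindL1_member[of A R "insert (Blind A R) \<Gamma>" A] D_weaken[OF R _ ok] by blast
    from IH[OF _ B this] have "\<Gamma> \<tturnstile> A" using True by auto
    then have "\<Gamma> \<tturnstile> Sign A K" using S K blindL2(8) by (intro D.signR) (auto simp: seqok_iff)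
    then have "insert R \<Gamma> \<tturnstile> Sign A K" using D_weaken D_ok[OF R] by blast
    from IH[OF _ this T] have "insert R \<Gamma> \<tturnstile> T" using True by auto
    from IH[OF _ R this] show ?thesis using True by auto
  next
    case False
    then show ?thesis using blindL2_member[OF _ R T] blindL2(6) by blast
  qed
next
  case (gs \<Delta> T A)
  have A: "\<Gamma> \<tturnstile> A" using gs(6)[OF gs(8-10)] .
  have T: "insert A \<Gamma> \<tturnstile> T" using gs(7)[of "insert A \<Gamma>"] gs(8-10) D_ok[OF A] by blast
  \<comment> \<open>gs may have looked into M only. If A is M, the second premise alone suffices; if
    A is a proper subterm, a smaller cut on A replaces gs.\<close>
  consider "A = M" | "size A < size M" | "\<exists>t\<in>insert T \<Gamma>. A \<in> subterms t"
    using gs(3,8) subterm_size[of A M] by blast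
  then show ?case
  proof cases
    case 1
    with gs(8) have "insert A \<Delta> \<subseteq> insert M \<Gamma>" by blast
    then show ?thesis using gs(7,9,10) by blast
  next
    case 2
    then show ?thesis using A T by (rule IH)
  next
    case 3
    then show ?thesis using gs_member[OF _ _ gs(2) A T] by blast
  qed
next
  case (cs \<Delta> T A)
  have A: "\<Gamma> \<tturnstile> A" using cs(5)[OF cs(7-9)] .
  have T: "insert A \<Gamma> \<tturnstile> T" using cs(6)[of "insert A \<Gamma>"] cs(7-9) D_ok[OF A] by blast
  consider "A = M" | "size A < size M" | "\<exists>t\<in>insert T \<Gamma>. A \<in> cross_sub th t"
    using cs(2,7) subterm_size[of A M] cross_sub_subterms[of th M] by blast
  then show ?case
  proof cases
    case 1
    with cs(7) have "insert A \<Delta> \<subseteq> insert M \<Gamma>" by blast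
    then show ?thesis using cs(6,8,9) by blast
  next
    case 2
    then show ?thesis using A T by (rule IH)
  next
    case 3
    then show ?thesis using cs_member[OF _ _ A T] by blast
  qed
qed

text \<open>Left rules, gs and cs at the end of the left derivation are permuted below the cut, with
  the right premise weakened; any other last rule leads to \<open>cut_principal\<close> or
  \<open>cut_foreign\<close>.\<close>

lemma cut_step:
  assumes IH: "\<And>A \<Gamma> T. size A < m \<Longrightarrow> \<Gamma> \<tturnstile> A \<Longrightarrow> insert A \<Gamma> \<tturnstile> T \<Longrightarrow> \<Gamma> \<tturnstile> T"
  shows "\<Gamma> \<tturnstile> M \<Longrightarrow> size M = m \<Longrightarrow> insert M \<Gamma> \<tturnstile> T \<Longrightarrow> \<Gamma> \<tturnstile> T"
proof (induction rule: D.induct)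
  case (idE \<Gamma> M i t)
  have M: "\<Gamma> \<tturnstile> M" using idE by (intro D.idE)
  have t: "M \<approx> t" using idE(4) by (simp add: conv_eqt)
  show ?case
  \<comment> \<open>A guarded M, public keys included, always falls into the second case, since its
    layer is \<open>None\<close>.\<close>
  proof (cases "layer th M = Some i")
    case True
    show ?thesis
    proof (rule cut_principal[OF _ M _ _ _ idE(6) order_refl order_refl])
      show "\<Gamma>' \<tturnstile> T'" if "size A < size M" "\<Gamma>' \<tturnstile> A" "insert A \<Gamma>' \<tturnstile> T'" for A \<Gamma>' T'
        using that(1)[unfolded idE(5)] that(2,3) by (rule IH)
      show "\<exists>s\<in>ectx ar th k \<Gamma>. M \<approx> s" if "layer th M = Some k" for k
        using that True t idE(3) by auto
      show "\<Gamma> \<tturnstile> A \<and> \<Gamma> \<tturnstile> B" if "M \<in> {Pair A B, Enc A B, Sign A B, Blind A B}" for A B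
        using that True by auto
      show "M \<noteq> Pub L" for L using True by auto
      show "ctx_ok \<Gamma>" using D_ok[OF M] by blast
    qed
  next
    case False
    then show ?thesis using cut_foreign[OF M idE(6) t idE(3)] by blast
  qed
next
  case (cut \<Gamma> T M)
  then show ?case by simp
next
  case (pL A B \<Gamma> M)
  have "insert M ({Pair A B, A, B} \<union> \<Gamma>) \<tturnstile> T"
    by (rule D_weaken[OF pL(5)]) (use D_ok[OF pL(2)] in auto)
  then have T: "{Pair A B, A, B} \<union> \<Gamma> \<tturnstile> T" by (rule pL(3)[OF pL(4)])
  have "seqok ar th ac n RE (insert (Pair A B) \<Gamma>) T" using D_ok[OF pL(5)] by (simp add: seqok_iff)
  then show ?case using T by (rule D.pL)
next
  case (pR \<Gamma> A B)
  have M: "\<Gamma> \<tturnstile> Pair A B" using pR(1-3) by (rule D.pR)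
  show ?case
  proof (rule cut_principal[OF _ M _ _ _ pR(7) order_refl order_refl])
    show "\<Gamma>' \<tturnstile> T'" if "size C < size (Pair A B)" "\<Gamma>' \<tturnstile> C" "insert C \<Gamma>' \<tturnstile> T'" for C \<Gamma>' T'
      using that(1)[unfolded pR(6)] that(2,3) by (rule IH)
    show "ctx_ok \<Gamma>" using D_ok[OF M] by blast
  qed (use pR(2,3) in auto)
next
  case (eL A K \<Gamma> M)
  have "insert M ({Enc A K, A, K} \<union> \<Gamma>) \<tturnstile> T"
    by (rule D_weaken[OF eL(7)]) (use D_ok[OF eL(3)] D_ok[OF eL(7)] in auto)
  then have T: "{Enc A K, A, K} \<union> \<Gamma> \<tturnstile> T" by (rule eL(5)[OF eL(6)])
  have "seqok ar th ac n RE (insert (Enc A K) \<Gamma>) T" using D_ok[OF eL(7)] by (simp add: seqok_iff)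
  then show ?case using eL(2) T by (rule D.eL)
next
  case (eR \<Gamma> A B)
  have M: "\<Gamma> \<tturnstile> Enc A B" using eR(1-3) by (rule D.eR)
  show ?case
  proof (rule cut_principal[OF _ M _ _ _ eR(7) order_refl order_refl])
    show "\<Gamma>' \<tturnstile> T'" if "size C < size (Enc A B)" "\<Gamma>' \<tturnstile> C" "insert C \<Gamma>' \<tturnstile> T'" for C \<Gamma>' T'
      using that(1)[unfolded eR(6)] that(2,3) by (rule IH)
    show "ctx_ok \<Gamma>" using D_ok[OF M] by blast
  qed (use eR(2,3) in auto)
next
  case (signL A K L \<Gamma> M)
  have "insert M ({Sign A K, Pub L, A} \<union> \<Gamma>) \<tturnstile> T"
    by (rule D_weaken[OF signL(6)]) (use D_ok[OF signL(3)] D_ok[OF signL(6)] in auto)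
  then have T: "{Sign A K, Pub L, A} \<union> \<Gamma> \<tturnstile> T" by (rule signL(4)[OF signL(5)])
  have "seqok ar th ac n RE ({Sign A K, Pub L} \<union> \<Gamma>) T" using D_ok[OF signL(6)] by (simp add: seqok_iff)
  then show ?case using signL(2) T by (rule D.signL)
next
  case (signR \<Gamma> A B)
  have M: "\<Gamma> \<tturnstile> Sign A B" using signR(1-3) by (rule D.signR)
  show ?case
  proof (rule cut_principal[OF _ M _ _ _ signR(7) order_refl order_refl])
    show "\<Gamma>' \<tturnstile> T'" if "size C < size (Sign A B)" "\<Gamma>' \<tturnstile> C" "insert C \<Gamma>' \<tturnstile> T'" for C \<Gamma>' T'
      using that(1)[unfolded signR(6)] that(2,3) by (rule IH)
    show "ctx_ok \<Gamma>" using D_ok[OF M] by blast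
  qed (use signR(2,3) in auto)
next
  case (blindL1 A K \<Gamma> M)
  have "insert M ({Blind A K, A, K} \<union> \<Gamma>) \<tturnstile> T"
    by (rule D_weaken[OF blindL1(7)]) (use D_ok[OF blindL1(3)] D_ok[OF blindL1(7)] in auto)
  then have T: "{Blind A K, A, K} \<union> \<Gamma> \<tturnstile> T" by (rule blindL1(5)[OF blindL1(6)])
  have "seqok ar th ac n RE (insert (Blind A K) \<Gamma>) T" using D_ok[OF blindL1(7)] by (simp add: seqok_iff)
  then show ?case using blindL1(2) T by (rule D.blindL1)
next
  case (blindR \<Gamma> A B)
  have M: "\<Gamma> \<tturnstile> Blind A B" using blindR(1-3) by (rule D.blindR)
  show ?case
  proof (rule cut_principal[OF _ M _ _ _ blindR(7) order_refl order_refl])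
    show "\<Gamma>' \<tturnstile> T'" if "size C < size (Blind A B)" "\<Gamma>' \<tturnstile> C" "insert C \<Gamma>' \<tturnstile> T'" for C \<Gamma>' T'
      using that(1)[unfolded blindR(6)] that(2,3) by (rule IH)
    show "ctx_ok \<Gamma>" using D_ok[OF M] by blast
  qed (use blindR(2,3) in auto)
next
  case (blindL2 A R K \<Gamma> M)
  have "insert M ({Sign (Blind A R) K, Sign A K, R} \<union> \<Gamma>) \<tturnstile> T"
    by (rule D_weaken[OF blindL2(7)]) (use D_ok[OF blindL2(3)] D_ok[OF blindL2(7)] in auto)
  then have T: "{Sign (Blind A R) K, Sign A K, R} \<union> \<Gamma> \<tturnstile> T" by (rule blindL2(5)[OF blindL2(6)])
  have "seqok ar th ac n RE (insert (Sign (Blind A R) K) \<Gamma>) T" using D_ok[OF blindL2(7)] by (simp add: seqok_iff)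
  then show ?case using blindL2(2) T by (rule D.blindL2)
next
  case (gs \<Gamma> M A)
  have "insert M (insert A \<Gamma>) \<tturnstile> T"
    by (rule D_weaken[OF gs(9)]) (use D_ok[OF gs(5)] D_ok[OF gs(9)] in auto)
  then have T: "insert A \<Gamma> \<tturnstile> T" by (rule gs(7)[OF gs(8)])
  \<comment> \<open>With M gone the side condition may fail. If A is M, its derivation is a left
    premise to which the induction hypothesis applies; if A is smaller, the outer induction
    does.\<close>
  consider "A = M" | "size A < m" | "\<exists>t\<in>insert T \<Gamma>. A \<in> subterms t"
    using gs(3,8) subterm_size[of A M] by blast
  then show ?case
  proof cases
    case 1
    then show ?thesis using gs(6,8,9) by simp
  next
    case 2
    then show ?thesis using gs(4) T by (rule IH)
  next
    case 3
    then show ?thesis using gs_member[OF _ _ gs(2,4) T] by blast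
  qed
next
  case (cs \<Gamma> M A)
  have "insert M (insert A \<Gamma>) \<tturnstile> T"
    by (rule D_weaken[OF cs(8)]) (use D_ok[OF cs(4)] D_ok[OF cs(8)] in auto)
  then have T: "insert A \<Gamma> \<tturnstile> T" by (rule cs(6)[OF cs(7)])
  consider "A = M" | "size A < m" | "\<exists>t\<in>insert T \<Gamma>. A \<in> cross_sub th t"
    using cs(2,7) subterm_size[of A M] cross_sub_subterms[of th M] by blast
  then show ?case
  proof cases
    case 1
    then show ?thesis using cs(5,7,8) by simp
  next
    case 2
    then show ?thesis using cs(3) T by (rule IH)
  next
    case 3
    then show ?thesis using cs_member[OF _ _ cs(3) T] by blast
  qed
qed

lemma cut_admissible: "\<Gamma> \<tturnstile> M \<Longrightarrow> insert M \<Gamma> \<tturnstile> T \<Longrightarrow> \<Gamma> \<tturnstile> T"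
proof (induction "size M" arbitrary: M \<Gamma> T rule: less_induct)
  case less
  show ?case by (rule cut_step[OF less.hyps less.prems(1) refl less.prems(2)])
qed

lemma cut_elimination:
  assumes "D ar th ac n Es RE c \<Gamma> M" shows "\<Gamma> \<tturnstile> M"
  using assms
proof (induction rule: D.induct)
  case (cut \<Gamma> T M)
  then show ?case using cut_admissible by blast
qed (blast intro: D.intros)+

end

theorem theorem3:
  fixes ar th :: "'f \<Rightarrow> nat" and ac :: "'f \<Rightarrow> bool" and n :: nat
    and Es :: "nat \<Rightarrow> ('f pat \<times> 'f pat) set" and RE :: "('f pat \<times> 'f pat) set"
    and \<Gamma> :: "'f trm set" and M :: "'f trm"
  assumes ac_binary: "\<forall>f. th f < n \<and> ac f \<longrightarrow> ar f = 2"
    and ac_unique: "\<forall>f g. th f < n \<and> ac f \<and> ac g \<and> th f = th g \<longrightarrow> f = g"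
    and Es_sig: "\<forall>i<n. \<forall>(l, r)\<in>Es i. pat_over ar (\<lambda>f. th f = i) l \<and> pat_over ar (\<lambda>f. th f = i) r"
    and Es_conv: "\<forall>i<n. \<exists>R. (\<forall>(l, r)\<in>R. pat_over ar (\<lambda>f. th f = i) l \<and> pat_over ar (\<lambda>f. th f = i) r)
                  \<and> conv (\<lambda>f. ac f \<and> th f = i) R = conv (\<lambda>f. ac f \<and> th f = i) (Es i)
                  \<and> convergent_mod (\<lambda>f. ac f \<and> th f = i) R"
    and RE_sig: "\<forall>(l, r)\<in>RE. pat_over ar (\<lambda>f. th f < n) l \<and> pat_over ar (\<lambda>f. th f < n) r"
    and RE_presents: "conv ac RE = conv ac (\<Union>i<n. Es i)"
    and RE_conv: "convergent_mod ac RE"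
    and derivable: "D ar th ac n Es RE True \<Gamma> M"
  shows "D ar th ac n Es RE False \<Gamma> M"
proof -
  interpret combination ar th ac n Es RE
    by unfold_locales (use Es_sig RE_presents RE_conv in \<open>auto intro!: pat_over_pure\<close>)
  show ?thesis using derivable by (rule cut_elimination)
qed

end
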